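(* Let $\phi\in(-1,1)$ and let $(Y_n)_{n\in\mathbb{N}}$ be the MA(1) process $Y_n=\varepsilon_n+\phi\,\varepsilon_{n-1}$, $n\in\mathbb{N}$, where $(\varepsilon_n)_{n\geq0}$ are i.i.d. $\mathcal{N}(0,1)$. For $n\in\mathbb{N}$ let $$\boldsymbol{S}_n=\frac1n\left(\sum_{k=1}^nY_k,\ \sum_{k=1}^nY_k^2\right).$$ Then $(\boldsymbol{S}_n)_{n\in\mathbb{N}}$ satisfies a large deviation principle (with speed $n$) in $\mathbb{R}^2$ with good rate function $$K_{\boldsymbol{S}}(x,y)=\begin{cases}K_\phi(y-x^2)+\dfrac{x^2}{2(1+\phi)^2}, & \text{if } y>x^2,\\ \infty, & \text{if } y\leq x^2,\end{cases}$$ where $K_\phi$ is the explicit function defined in the context.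
   Context: For $x>0$ define $$A_\phi(x)=4x\left(x(\phi^2+1)-(\phi^2-1)^2\right),$$ $$B_\phi(x)=4x^2\left(x^2(\phi^4+14\phi^2+1)+4x(\phi^2+1)(\phi^2-1)^2+(\phi^2-1)^4\right),$$ $$\begin{aligned}c_\phi(x)=-x^8(\phi^2-1)^4\Big(&4x^4\phi^2+32x^3(\phi^4+\phi^2)+x^2(\phi^4+46\phi^2+1)(\phi^2-1)^2\\&+6x(\phi^2+1)(\phi^2-1)^4+(\phi^2-1)^6\Big),\end{aligned}$$ $$\begin{aligned}C_\phi(x)=-(1+i\sqrt3)\Big[&-x^6(\phi^6-33\phi^4-33\phi^2+1)-6x^5(\phi^2-1)^2(\phi^4-10\phi^2+1)\\&+6x^4(\phi^2-1)^4(\phi^2+1)+x^3(\phi^2-1)^6+3\sqrt3\sqrt{c_\phi(x)}\Big]^{1/3},\end{aligned}$$ where the complex square root and cube root are principal branches. Set $$\lambda_\phi(x)=\frac{A_\phi(x)+\frac{B_\phi(x)}{C_\phi(x)}+C_\phi(x)}{12x^2(\phi^2-1)^2}$$ (which is a real number for $x>0$), and $$K_\phi(x)=x\lambda_\phi(x)+\frac12\log\left[\frac{1-2\lambda_\phi(x)(1+\phi^2)+\sqrt{(1-2\lambda_\phi(x)(1+\phi^2))^2-16\lambda_\phi(x)^2\phi^2}}{2}\right]\quad\text{for }x>0,$$ with $K_\phi(x)=\infty$ for $x\leq0$. A sequence of random vectors $(\boldsymbol{V}_n)$ of $\mathbb{R}^d$ satisfies a large deviation principle (LDP) with speed $n$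 and rate function $J$ if $J:\mathbb{R}^d\to[0,\infty]$ is lower semicontinuous and (i) for every closed $F\subset\mathbb{R}^d$, $\limsup_{n\to\infty}\frac1n\log\mathbb{P}(\boldsymbol{V}_n\in F)\leq-\inf_{\boldsymbol{x}\in F}J(\boldsymbol{x})$; (ii) for every open $G\subset\mathbb{R}^d$, $-\inf_{\boldsymbol{x}\in G}J(\boldsymbol{x})\leq\liminf_{n\to\infty}\frac1n\log\mathbb{P}(\boldsymbol{V}_n\in G)$. The rate function is good if its level sets $J^{-1}([0,b])$ are compact for all $b\in\mathbb{R}$. Here $\mathbb{N}=\{1,2,\dots\}$. *)

theory Defs
  imports "HOL-Probability.Probability"
begin

section \<open>Large deviation principles\<close>

text \<open>The logarithm of a probability, with \<open>log 0 = -\<infinity>\<close> (for real \<open>ln\<close> one has \<open>ln 0 = 0\<close>).\<close>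

definition log_prob :: "real \<Rightarrow> ereal" where
  "log_prob p = (if p = 0 then -\<infinity> else ereal (ln p))"

definition lower_semicontinuous :: "('b::topological_space \<Rightarrow> ereal) \<Rightarrow> bool" where
  "lower_semicontinuous J \<longleftrightarrow> (\<forall>x. J x \<le> Liminf (at x) J)"

text \<open>
  Sequences are indexed by \<open>n \<ge> 1\<close>; the entry \<open>V 0\<close> is unconstrained and does not affect the
  limits. An infimum over the empty set is \<open>\<infinity>\<close>.
\<close>

definition satisfies_LDP ::
  "'a measure \<Rightarrow> (nat \<Rightarrow> 'a \<Rightarrow> 'b::euclidean_space) \<Rightarrow> ('b \<Rightarrow> ereal) \<Rightarrow> bool" where
  "satisfies_LDP M V J \<longleftrightarrow>
     (\<forall>n\<ge>1. V n \<in> borel_measurable M) \<and>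
     (\<forall>x. 0 \<le> J x) \<and>
     lower_semicontinuous J \<and>
     (\<forall>F. closed F \<longrightarrow>
        limsup (\<lambda>n. ereal (1 / real n) * log_prob (measure M {\<omega> \<in> space M. V n \<omega> \<in> F}))
          \<le> - (INF x\<in>F. J x)) \<and>
     (\<forall>G. open G \<longrightarrow>
        - (INF x\<in>G. J x)
          \<le> liminf (\<lambda>n. ereal (1 / real n) * log_prob (measure M {\<omega> \<in> space M. V n \<omega> \<in> G})))"

definition good_rate :: "('b::topological_space \<Rightarrow> ereal) \<Rightarrow> bool" where
  "good_rate J \<longleftrightarrow> (\<forall>b::real. compact (J -` {0..ereal b}))"

section \<open>The MA(1) process\<close>

text \<open>Only the values at \<open>n \<ge> 1\<close> are meaningful (natural-number subtraction truncates).\<close>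

definition ma1 :: "real \<Rightarrow> (nat \<Rightarrow> 'a \<Rightarrow> real) \<Rightarrow> nat \<Rightarrow> 'a \<Rightarrow> real" where
  "ma1 \<phi> \<epsilon> n \<omega> = \<epsilon> n \<omega> + \<phi> * \<epsilon> (n - 1) \<omega>"

definition S_vec :: "(nat \<Rightarrow> 'a \<Rightarrow> real) \<Rightarrow> nat \<Rightarrow> 'a \<Rightarrow> real \<times> real" where
  "S_vec Y n \<omega> = (1 / real n) *\<^sub>R (\<Sum>k=1..n. Y k \<omega>, \<Sum>k=1..n. (Y k \<omega>)\<^sup>2)"

section \<open>The explicit rate function\<close>

definition A_fun :: "real \<Rightarrow> real \<Rightarrow> real" where
  "A_fun \<phi> x = 4 * x * (x * (\<phi>^2 + 1) - (\<phi>^2 - 1)^2)"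

definition B_fun :: "real \<Rightarrow> real \<Rightarrow> real" where
  "B_fun \<phi> x = 4 * x^2 * (x^2 * (\<phi>^4 + 14 * \<phi>^2 + 1)
      + 4 * x * (\<phi>^2 + 1) * (\<phi>^2 - 1)^2 + (\<phi>^2 - 1)^4)"

definition c_fun :: "real \<Rightarrow> real \<Rightarrow> real" where
  "c_fun \<phi> x = - (x^8) * (\<phi>^2 - 1)^4 *
      (4 * x^4 * \<phi>^2 + 32 * x^3 * (\<phi>^4 + \<phi>^2)
       + x^2 * (\<phi>^4 + 46 * \<phi>^2 + 1) * (\<phi>^2 - 1)^2
       + 6 * x * (\<phi>^2 + 1) * (\<phi>^2 - 1)^4 + (\<phi>^2 - 1)^6)"

text \<open>The functions \<open>csqrt\<close> and \<open>powr\<close> on \<open>complex\<close> are the principal branches.\<close>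

definition C_fun :: "real \<Rightarrow> real \<Rightarrow> complex" where
  "C_fun \<phi> x = - (1 + \<i> * complex_of_real (sqrt 3)) *
     (complex_of_real
        (- (x^6) * (\<phi>^6 - 33 * \<phi>^4 - 33 * \<phi>^2 + 1)
         - 6 * x^5 * (\<phi>^2 - 1)^2 * (\<phi>^4 - 10 * \<phi>^2 + 1)
         + 6 * x^4 * (\<phi>^2 - 1)^4 * (\<phi>^2 + 1)
         + x^3 * (\<phi>^2 - 1)^6)
      + 3 * complex_of_real (sqrt 3) * csqrt (complex_of_real (c_fun \<phi> x))) powr (1 / 3)"

definition lambda_complex :: "real \<Rightarrow> real \<Rightarrow> complex" where
  "lambda_complex \<phi> x =
     (complex_of_real (A_fun \<phi> x) + complex_of_real (B_fun \<phi> x) / C_fun \<phi> x + C_fun \<phi> x)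
     / complex_of_real (12 * x^2 * (\<phi>^2 - 1)^2)"

text \<open>
  For \<open>x > 0\<close> and \<open>\<bar>\<phi>\<bar> < 1\<close> the value \<open>lambda_complex \<phi> x\<close> is real, so taking the real part
  only changes the type; see \<open>lambda_complex_real\<close>.
\<close>

definition lambda_fun :: "real \<Rightarrow> real \<Rightarrow> real" where
  "lambda_fun \<phi> x = Re (lambda_complex \<phi> x)"

lemma discriminant_identity:
  fixes q x :: real
  shows "(- (x^3) * (q^3 - 33*q^2 - 33*q + 1) - 6*x^2*(q - 1)^2*(q^2 - 10*q + 1)
            + 6*x*(q - 1)^4*(q + 1) + (q - 1)^6)^2
         + 27 * x^2 * (q - 1)^4 *
           (4*x^4*q + 32*x^3*(q^2 + q) + x^2*(q^2 + 46*q + 1)*(q - 1)^2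
            + 6*x*(q + 1)*(q - 1)^4 + (q - 1)^6)
         = (x^2*(q^2 + 14*q + 1) + 4*x*(q + 1)*(q - 1)^2 + (q - 1)^4)^3"
  by algebra

lemma lambda_complex_real:
  assumes phi: "\<phi> \<in> {-1<..<1}" and x: "x > 0"
  shows "lambda_complex \<phi> x = complex_of_real (lambda_fun \<phi> x)"
proof -
  define R where "R = - (x^6) * (\<phi>^6 - 33 * \<phi>^4 - 33 * \<phi>^2 + 1)
         - 6 * x^5 * (\<phi>^2 - 1)^2 * (\<phi>^4 - 10 * \<phi>^2 + 1)
         + 6 * x^4 * (\<phi>^2 - 1)^4 * (\<phi>^2 + 1)
         + x^3 * (\<phi>^2 - 1)^6"
  define c where "c = c_fun \<phi> x"
  define z where "z = complex_of_real R + 3 * complex_of_real (sqrt 3) * csqrt (complex_of_real c)"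
  define C where "C = C_fun \<phi> x"
  define B where "B = B_fun \<phi> x"
  have C_eq: "C = - (1 + \<i> * complex_of_real (sqrt 3)) * z powr (1/3)"
    unfolding C_def C_fun_def z_def R_def c_def ..
  have "\<phi>^2 < 1" using phi by (simp add: abs_square_less_1 abs_less_iff)
  then have p: "\<phi>^2 - 1 \<noteq> 0" by simp
  have "0 < (4 * x^4 * \<phi>^2 + 32 * x^3 * (\<phi>^4 + \<phi>^2)
       + x^2 * (\<phi>^4 + 46 * \<phi>^2 + 1) * (\<phi>^2 - 1)^2
       + 6 * x * (\<phi>^2 + 1) * (\<phi>^2 - 1)^4 + (\<phi>^2 - 1)^6)"
    using x p by (intro add_nonneg_pos add_nonneg_nonneg mult_nonneg_nonneg) auto
  then have c_neg: "c < 0"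
    unfolding c_def c_fun_def using x p by (simp add: mult_neg_pos)
  have "csqrt (complex_of_real c) = \<i> * complex_of_real (sqrt (- c))"
    using c_neg by (simp add: csqrt_of_real_nonpos)
  then have z: "z = Complex R (3 * sqrt 3 * sqrt (- c))"
    by (simp add: z_def complex_eq_iff)
  have B_nonneg: "B \<ge> 0"
    unfolding B_def B_fun_def using x by (intro mult_nonneg_nonneg add_nonneg_nonneg) auto
  have "(cmod z)^2 = R^2 - 27 * c"
    using c_neg by (simp add: z cmod_power2 power_mult_distrib)
  moreover have "64 * (R^2 - 27 * c) = B^3"
  proof -
    define q where "q = \<phi>^2"
    define r where "r = - (x^3) * (q^3 - 33*q^2 - 33*q + 1) - 6*x^2*(q - 1)^2*(q^2 - 10*q + 1)
            + 6*x*(q - 1)^4*(q + 1) + (q - 1)^6"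
    define s where "s = 4*x^4*q + 32*x^3*(q^2 + q) + x^2*(q^2 + 46*q + 1)*(q - 1)^2
            + 6*x*(q + 1)*(q - 1)^4 + (q - 1)^6"
    define b where "b = x^2*(q^2 + 14*q + 1) + 4*x*(q + 1)*(q - 1)^2 + (q - 1)^4"
    have q: "\<phi>^4 = q^2" "\<phi>^6 = q^3" by (simp_all add: q_def flip: power_mult)
    have xs: "x^6 = x^3 * x^3" "x^5 = x^3 * x^2" "x^4 = x^3 * x"
      by (simp_all add: eval_nat_numeral)
    have "R = x^3 * r"
      unfolding R_def q q_def[symmetric] r_def xs by (simp only: distrib_left right_diff_distrib mult_ac mult_minus_left mult_minus_right)
    moreover have "c = - (x^8) * (q - 1)^4 * s"
      unfolding c_def c_fun_def q q_def[symmetric] s_def ..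
    moreover have "B = 4 * x^2 * b"
      unfolding B_def B_fun_def q q_def[symmetric] b_def ..
    moreover have "r^2 + 27 * x^2 * (q - 1)^4 * s = b^3"
      unfolding r_def s_def b_def by (rule discriminant_identity)
    moreover have "64 * ((x^3 * r)^2 - 27 * (- (x^8) * (q - 1)^4 * s))
        = (4 * x^2)^3 * (r^2 + 27 * x^2 * (q - 1)^4 * s)"
      by algebra
    ultimately show ?thesis by (simp only: power_mult_distrib)
  qed
  ultimately have key: "64 * (cmod z)^2 = B^3" by simp
  have z0: "z \<noteq> 0" using c_neg by (simp add: z complex_eq_iff)
  have "cmod (- (1 + \<i> * complex_of_real (sqrt 3))) = 2"
    by (simp add: cmod_def)
  then have "cmod C = 2 * cmod (z powr (1/3))"
    by (simp only: C_eq norm_mult)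
  also have "cmod (z powr (1/3)) = cmod z powr (1/3)"
    using norm_powr_complex[of z "1/3"] by simp
  finally have cmod_C: "cmod C = 2 * cmod z powr (1/3)" .
  then have "cmod C ^ 6 = 64 * (cmod z powr (1/3)) ^ 6"
    by (simp add: power_mult_distrib)
  also have "(cmod z powr (1/3)) ^ 6 = (cmod z powr (1/3)) powr (real 6)"
    using z0 by (subst powr_realpow) auto
  also have "\<dots> = cmod z powr (real 2)"
    by (simp add: powr_powr)
  also have "\<dots> = (cmod z)^2"
    using z0 by (subst powr_realpow) auto
  finally have "((cmod C)^2)^3 = B^3"
    using key by (simp flip: power_mult)
  then have CB: "(cmod C)^2 = B"
    using B_nonneg by (metis power_eq_imp_eq_base zero_le_power2 zero_less_numeral)
  have "cmod C \<noteq> 0" using z0 cmod_C by simp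
  then have C0: "C \<noteq> 0" by simp
  have "complex_of_real B / C = cnj C"
    using C0 complex_norm_square[of C] by (simp add: CB[symmetric] field_simps)
  then have "lambda_complex \<phi> x = (complex_of_real (A_fun \<phi> x) + (C + cnj C))
      / complex_of_real (12 * x^2 * (\<phi>^2 - 1)^2)"
    unfolding lambda_complex_def B_def C_def by (simp add: add_ac)
  also have "\<dots> = complex_of_real ((A_fun \<phi> x + 2 * Re C) / (12 * x^2 * (\<phi>^2 - 1)^2))"
    by (simp add: complex_add_cnj)
  finally show ?thesis by (simp add: lambda_fun_def)
qed

definition K_fun :: "real \<Rightarrow> real \<Rightarrow> ereal" where
  "K_fun \<phi> x =
     (if x > 0 then
        ereal (let l = lambda_fun \<phi> x in
          x * l + 1 / 2 * ln ((1 - 2 * l * (1 + \<phi>^2)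
             + sqrt ((1 - 2 * l * (1 + \<phi>^2))^2 - 16 * l^2 * \<phi>^2)) / 2))
      else \<infinity>)"

definition K_S :: "real \<Rightarrow> real \<times> real \<Rightarrow> ereal" where
  "K_S \<phi> = (\<lambda>(x, y).
     if y > x^2 then K_fun \<phi> (y - x^2) + ereal (x^2 / (2 * (1 + \<phi>)^2)) else \<infinity>)"

end

theory Submission
  imports Defs
begin

text \<open>
  The proof follows the Gartner-Ellis method. Let \<open>f \<theta> = |1 + \<phi> e\<^sup>i\<^sup>\<theta>|\<^sup>2\<close> be the spectral density of the
  process; its extreme values are \<open>(1 + \<phi>)\<^sup>2 = f 0\<close> and \<open>(1 - \<phi>)\<^sup>2\<close>. When \<open>2 s f < 1\<close> everywhere,
  \<open>1/n\<close> times the logarithm of the expectation of \<open>exp (t \<Sum> Y + s \<Sum> Y\<^sup>2)\<close> tends to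
  \<open>\<Lambda> (t, s) = t\<^sup>2 f 0 / (2 (1 - 2 s f 0)) - log ((\<surd>p + \<surd>q) / 2)\<close>, with
  \<open>p = 1 - 2 s (1 + \<phi>)\<^sup>2\<close> and \<open>q = 1 - 2 s (1 - \<phi>)\<^sup>2\<close>. Since consecutive \<open>Y\<close> share only one noise
  variable, this needs no asymptotics of Toeplitz determinants: integrating out one noise variable at a
  time (\<open>nn_integral_ma1\<close>) gives an exact formula in terms of scalar recursions, and these converge
  geometrically to an attracting fixed point (\<open>ma1_prec_bounds_and_limit\<close>, \<open>ma1_mgf\<close>).

  The general large deviation statement (\<open>LDP_if_rate_points_are_gradients\<close>) is elementary. The upper
  bound comes from Chernoff bounds for half-spaces, finitely many of which cover a closed set. The lower
  bound comes from exponential tilting, and it asks that every point of finite rate be a gradient of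
  \<open>\<Lambda>\<close> on the domain.

  It remains to compute the Legendre transform. Optimizing over \<open>t\<close> leaves the supremum over \<open>s\<close> of
  \<open>s c + log ((\<surd>p + \<surd>q) / 2)\<close> with \<open>c = y - x\<^sup>2\<close>, and the term \<open>x\<^sup>2 / (2 (1 + \<phi>)\<^sup>2)\<close>. This function is
  concave, and its stationary point solves \<open>\<surd>p \<surd>q (1 + 2 s c) = 1\<close>, which becomes a cubic equation after squaring
  and removing the root \<open>0\<close>. The signs of the cubic at the ends of the admissible interval show that
  the middle root is the stationary point, and the branches in \<open>C_fun\<close> are such that Cardano's formula
  yields the middle root (\<open>Cardano_complex\<close>, \<open>lambda_fun_critical\<close>). Hence \<open>K_S\<close> is the Legendre
  transform of \<open>\<Lambda>\<close> (\<open>K_S_eq_Legendre_transform\<close>), and the maximizing parameter exhibits each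
  point with \<open>y > x\<^sup>2\<close> as a gradient (\<open>K_S_finite_imp_gradient\<close>).
\<close>

section \<open>Large deviations from limits of moment generating functions\<close>

text \<open>
  The Gartner-Ellis setting. The moment generating functions may be infinite off the open set \<open>D\<close>; the
  Legendre transform \<open>rate\<close> below is a supremum over \<open>D\<close> only.
\<close>

locale log_mgf_limit = prob_space M for M :: "'a measure" +
  fixes V :: "nat \<Rightarrow> 'a \<Rightarrow> 'b::euclidean_space" and D :: "'b set" and \<Lambda> :: "'b \<Rightarrow> real"
  assumes V_measurable: "\<And>n. n \<ge> 1 \<Longrightarrow> V n \<in> borel_measurable M"
    and open_D: "open D" and zero_in_D: "0 \<in> D"
    and integrable_exp: "\<And>\<theta> n. \<theta> \<in> D \<Longrightarrow> n \<ge> 1 \<Longrightarrow>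
          integrable M (\<lambda>\<omega>. exp (real n * (\<theta> \<bullet> V n \<omega>)))"
    and log_mgf_tendsto: "\<And>\<theta>. \<theta> \<in> D \<Longrightarrow>
          (\<lambda>n. ln (expectation (\<lambda>\<omega>. exp (real n * (\<theta> \<bullet> V n \<omega>)))) / real n) \<longlonglongrightarrow> \<Lambda> \<theta>"
begin

definition mgf :: "nat \<Rightarrow> 'b \<Rightarrow> real" where
  "mgf n \<theta> = expectation (\<lambda>\<omega>. exp (real n * (\<theta> \<bullet> V n \<omega>)))"

definition rate :: "'b \<Rightarrow> ereal" where
  "rate x = (SUP \<theta>\<in>D. ereal (\<theta> \<bullet> x - \<Lambda> \<theta>))"

lemma mgf_pos:
  assumes "\<theta> \<in> D" "n \<ge> 1" shows "mgf n \<theta> > 0"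
proof -
  have "mgf n \<theta> \<ge> 0" unfolding mgf_def by (intro integral_nonneg_AE) auto
  moreover have "mgf n \<theta> \<noteq> 0"
  proof
    assume "mgf n \<theta> = 0"
    then have "AE \<omega> in M. exp (real n * (\<theta> \<bullet> V n \<omega>)) = 0"
      unfolding mgf_def using integrable_exp[OF assms]
      by (subst (asm) integral_nonneg_eq_0_iff_AE) auto
    then show False by simp
  qed
  ultimately show ?thesis by simp
qed

lemma mgf_eventually_le:
  assumes "\<theta> \<in> D" "\<Lambda> \<theta> < c"
  shows "\<forall>\<^sub>F n in sequentially. mgf n \<theta> \<le> exp (real n * c)"
  using order_tendstoD(2)[OF log_mgf_tendsto[OF assms(1)] assms(2)] eventually_ge_at_top[of 1]
proof eventually_elim
  case (elim n)
  then have "ln (mgf n \<theta>) < real n * c" by (simp add: mgf_def field_simps)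
  then show ?case using mgf_pos[OF assms(1) elim(2)]
    by (metis exp_le_cancel_iff exp_ln less_imp_le)
qed

lemma mgf_eventually_ge:
  assumes "\<theta> \<in> D" "c < \<Lambda> \<theta>"
  shows "\<forall>\<^sub>F n in sequentially. exp (real n * c) \<le> mgf n \<theta>"
  using order_tendstoD(1)[OF log_mgf_tendsto[OF assms(1)] assms(2)] eventually_ge_at_top[of 1]
proof eventually_elim
  case (elim n)
  then have "real n * c < ln (mgf n \<theta>)" by (simp add: mgf_def field_simps)
  then show ?case using mgf_pos[OF assms(1) elim(2)]
    by (metis exp_le_cancel_iff exp_ln less_imp_le)
qed

lemma \<Lambda>_zero: "\<Lambda> 0 = 0"
proof -
  have "(\<lambda>n. 0) \<longlonglongrightarrow> \<Lambda> 0" using log_mgf_tendsto[OF zero_in_D] by (simp add: prob_space)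
  then show ?thesis by (simp add: LIMSEQ_const_iff)
qed

lemma rate_ge: "\<theta> \<in> D \<Longrightarrow> ereal (\<theta> \<bullet> x - \<Lambda> \<theta>) \<le> rate x"
  unfolding rate_def by (rule SUP_upper)

lemma rate_nonneg: "0 \<le> rate x"
  using rate_ge[OF zero_in_D, of x] by (simp add: \<Lambda>_zero zero_ereal_def)

lemma open_rate_greater: "open {x. a < rate x}"
proof -
  have "{x. a < rate x} = (\<Union>\<theta>\<in>D. {x. a < ereal (\<theta> \<bullet> x - \<Lambda> \<theta>)})"
    unfolding rate_def by (auto simp: less_SUP_iff)
  moreover have "open {x. a < ereal (\<theta> \<bullet> x - \<Lambda> \<theta>)}" for \<theta>
  proof (cases a)
    case (real r)
    have "open {x. r < \<theta> \<bullet> x - \<Lambda> \<theta>}"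
      by (intro open_Collect_less continuous_intros)
    then show ?thesis using real by simp
  qed auto
  ultimately show ?thesis by auto
qed

lemma lower_semicontinuous_rate: "lower_semicontinuous rate"
  unfolding lower_semicontinuous_def le_Liminf_iff
proof (intro allI impI)
  fix x a assume "a < rate x"
  then have "eventually (\<lambda>y. y \<in> {x. a < rate x}) (nhds x)"
    by (intro eventually_nhds_in_open open_rate_greater) auto
  then show "\<forall>\<^sub>F y in at x. a < rate y" by (auto simp: eventually_at_filter elim: eventually_mono)
qed

text \<open>
  Exponential tightness in geometric form. Because \<open>0\<close> is interior to \<open>D\<close>, small multiples \<open>h\<close> of
  \<open>\<plusminus>\<close> the basis vectors lie in \<open>D\<close>, and their half-spaces already cover the complement of a large box.
  Both the compactness of the level sets and the upper bound for unbounded closed sets come from this.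
\<close>

lemma finite_halfspaces_outside_box:
  obtains T K where "finite T" "T \<subseteq> D" "compact K" "\<And>x. x \<notin> K \<Longrightarrow> \<exists>\<theta>\<in>T. a < \<theta> \<bullet> x - \<Lambda> \<theta>"
proof -
  obtain e where e: "e > 0" "ball 0 e \<subseteq> D" using open_D zero_in_D by (meson openE)
  define h where "h = e / 2"
  define T where "T = (\<lambda>i. h *\<^sub>R i) ` Basis \<union> (\<lambda>i. - (h *\<^sub>R i)) ` (Basis :: 'b set)"
  have h: "h > 0" using e by (simp add: h_def)
  have fin: "finite T" by (simp add: T_def)
  have TD: "T \<subseteq> D" using e by (auto simp: T_def h_def intro!: subsetD[OF e(2)])
  define R where "R = (\<bar>a\<bar> + (\<Sum>\<theta>\<in>T. \<bar>\<Lambda> \<theta>\<bar>) + 1) / h"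
  define K :: "'b set" where "K = cbox (- (\<Sum>i\<in>Basis. R *\<^sub>R i)) (\<Sum>i\<in>Basis. R *\<^sub>R i)"
  have far: "a < v - \<Lambda> \<theta>" if "\<theta> \<in> T" "h * R < v" for \<theta> v
  proof -
    have "\<bar>\<Lambda> \<theta>\<bar> \<le> (\<Sum>\<theta>\<in>T. \<bar>\<Lambda> \<theta>\<bar>)" using that fin by (intro member_le_sum) auto
    then show ?thesis using that h by (simp add: R_def)
  qed
  have "\<exists>\<theta>\<in>T. a < \<theta> \<bullet> x - \<Lambda> \<theta>" if x: "x \<notin> K" for x
  proof -
    obtain i where i: "i \<in> Basis" "x \<bullet> i > R \<or> x \<bullet> i < - R"
      using x by (auto simp: K_def mem_box inner_minus_left not_le)
    from i(2) show ?thesis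
    proof
      assume "x \<bullet> i > R"
      then have "h * R < (h *\<^sub>R i) \<bullet> x" using h by (simp add: inner_commute)
      moreover have "h *\<^sub>R i \<in> T" using i(1) unfolding T_def by blast
      ultimately show ?thesis using far by blast
    next
      assume "x \<bullet> i < - R"
      then have "h * R < h * (- (x \<bullet> i))" using h by (intro mult_strict_left_mono) auto
      then have "h * R < (- (h *\<^sub>R i)) \<bullet> x" by (simp add: inner_commute)
      moreover have "- (h *\<^sub>R i) \<in> T" using i(1) unfolding T_def by blast
      ultimately show ?thesis using far by blast
    qed
  qed
  then show ?thesis using that[of T K] fin TD by (auto simp: K_def)
qed

lemma good_rate_rate: "good_rate rate"
  unfolding good_rate_def
proof
  fix b :: real
  obtain T K where T: "finite T" "T \<subseteq> D" "compact K" "\<And>x. x \<notin> K \<Longrightarrow> \<exists>\<theta>\<in>T. b < \<theta> \<bullet> x - \<Lambda> \<theta>"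
    using finite_halfspaces_outside_box[of b] by blast
  have eq: "rate -` {0..ereal b} = - {x. ereal b < rate x}"
    using rate_nonneg by auto
  have "rate -` {0..ereal b} \<subseteq> K"
  proof
    fix x assume x: "x \<in> rate -` {0..ereal b}"
    show "x \<in> K"
    proof (rule ccontr)
      assume "x \<notin> K"
      then obtain \<theta> where "\<theta> \<in> T" "b < \<theta> \<bullet> x - \<Lambda> \<theta>" using T(4) by blast
      then have "ereal b < rate x" using rate_ge[of \<theta> x] T(2)
        by (meson less_ereal.simps(1) order_less_le_trans subsetD)
      then show False using x by auto
    qed
  qed
  moreover have "closed (rate -` {0..ereal b})"
    unfolding eq using open_rate_greater by (rule closed_Compl)
  ultimately show "compact (rate -` {0..ereal b})"
    using compact_Int_closed[OF T(3)] by (metis inf.absorb_iff2)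
qed

text \<open>
  Compactness reduces the upper bound for \<open>F\<close> to Chernoff bounds for finitely many half-spaces: a point
  with rate above \<open>a\<close> lies, by definition of the supremum, in an open half-space whose Chernoff exponent
  exceeds \<open>a\<close>.
\<close>

lemma finite_halfspace_cover:
  assumes F: "closed F" and J: "\<And>x. x \<in> F \<Longrightarrow> ereal a < rate x"
  obtains T where "finite T" "T \<subseteq> D" "\<And>x. x \<in> F \<Longrightarrow> \<exists>\<theta>\<in>T. a < \<theta> \<bullet> x - \<Lambda> \<theta>"
proof -
  obtain T K where T: "finite T" "T \<subseteq> D" "compact K" "\<And>x. x \<notin> K \<Longrightarrow> \<exists>\<theta>\<in>T. a < \<theta> \<bullet> x - \<Lambda> \<theta>"
    using finite_halfspaces_outside_box[of a] by blast
  have "compact (K \<inter> F)" using T(3) F by (rule compact_Int_closed)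
  moreover have "open {x. a < \<theta> \<bullet> x - \<Lambda> \<theta>}" for \<theta>
    by (intro open_Collect_less continuous_intros)
  moreover have "K \<inter> F \<subseteq> (\<Union>\<theta>\<in>D. {x. a < \<theta> \<bullet> x - \<Lambda> \<theta>})"
    using J unfolding rate_def by (fastforce simp: less_SUP_iff)
  ultimately obtain T' where T': "T' \<subseteq> D" "finite T'" "K \<inter> F \<subseteq> (\<Union>\<theta>\<in>T'. {x. a < \<theta> \<bullet> x - \<Lambda> \<theta>})"
    by (elim compactE_image) auto
  have "\<exists>\<theta>\<in>T \<union> T'. a < \<theta> \<bullet> x - \<Lambda> \<theta>" if "x \<in> F" for x
  proof (cases "x \<in> K")
    case True
    then show ?thesis using that T'(3) by blast
  qed (use T(4) in blast)
  then show ?thesis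
    by (intro that[of "T \<union> T'"]) (use T T' in auto)
qed

lemma prob_halfspace_le:
  assumes "\<theta> \<in> D" "n \<ge> 1"
  shows "prob {\<omega> \<in> space M. c < \<theta> \<bullet> V n \<omega>} \<le> exp (- (real n * c)) * mgf n \<theta>"
proof -
  note [measurable] = V_measurable[OF assms(2)]
  have "prob {\<omega> \<in> space M. c < \<theta> \<bullet> V n \<omega>} = expectation (indicator {\<omega> \<in> space M. c < \<theta> \<bullet> V n \<omega>})"
    by (simp)
  also have "\<dots> \<le> expectation (\<lambda>\<omega>. exp (- (real n * c)) * exp (real n * (\<theta> \<bullet> V n \<omega>)))"
  proof (rule integral_mono)
    show "integrable M (indicator {\<omega> \<in> space M. c < \<theta> \<bullet> V n \<omega>} :: _ \<Rightarrow> real)"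
      by (intro integrable_const_bound[where B=1]) auto
    show "integrable M (\<lambda>\<omega>. exp (- (real n * c)) * exp (real n * (\<theta> \<bullet> V n \<omega>)))"
      using integrable_exp[OF assms] by simp
    show "indicator {\<omega> \<in> space M. c < \<theta> \<bullet> V n \<omega>} \<omega> \<le> exp (- (real n * c)) * exp (real n * (\<theta> \<bullet> V n \<omega>))" for \<omega>
      by (auto simp: indicator_def mult_exp_exp intro!: mult_left_mono)
  qed
  also have "\<dots> = exp (- (real n * c)) * mgf n \<theta>" by (simp add: mgf_def)
  finally show ?thesis .
qed

lemma limsup_log_prob_le:
  assumes P: "\<forall>\<^sub>F n in sequentially. P n \<le> C * exp (- (real n * r))" and C: "C > 0" and P0: "\<And>n. P n \<ge> 0"
  shows "limsup (\<lambda>n. ereal (1 / real n) * log_prob (P n)) \<le> ereal (- r)"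
proof -
  have "limsup (\<lambda>n. ereal (1 / real n) * log_prob (P n)) \<le> limsup (\<lambda>n. ereal (ln C / real n - r))"
  proof (rule Limsup_mono)
    show "\<forall>\<^sub>F n in sequentially. ereal (1 / real n) * log_prob (P n) \<le> ereal (ln C / real n - r)"
      using P eventually_ge_at_top[of 1]
    proof eventually_elim
      case (elim n)
      show ?case
      proof (cases "P n = 0")
        case False
        then have pos: "P n > 0" using P0[of n] by simp
        then have "ln (P n) \<le> ln (C * exp (- (real n * r)))" using elim by simp
        also have "\<dots> = ln C - real n * r" using C by (simp add: ln_mult)
        finally have "ln (P n) / real n \<le> (ln C - real n * r) / real n"
          by (rule divide_right_mono) simp
        then show ?thesis using False elim(2) by (simp add: log_prob_def diff_divide_distrib)
      qed (use elim in \<open>simp add: log_prob_def\<close>)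
    qed
  qed
  also have "limsup (\<lambda>n. ereal (ln C / real n - r)) = ereal (- r)"
  proof (rule lim_imp_Limsup)
    have "(\<lambda>n. ln C / real n - r) \<longlonglongrightarrow> 0 - r"
      by (intro tendsto_intros lim_const_over_n)
    then show "(\<lambda>n. ereal (ln C / real n - r)) \<longlonglongrightarrow> ereal (- r)" by simp
  qed simp
  finally show ?thesis .
qed

lemma upper_bound:
  assumes F: "closed F"
  shows "limsup (\<lambda>n. ereal (1 / real n) * log_prob (prob {\<omega> \<in> space M. V n \<omega> \<in> F})) \<le> - (INF x\<in>F. rate x)"
    (is "?S \<le> - ?I")
proof -
  have key: "?S \<le> ereal (- r)" if r: "ereal r < ?I" for r
  proof -
    obtain a where a: "ereal r < ereal a" "ereal a < ?I" using r ereal_dense2 by blast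
    have "ereal a < rate x" if "x \<in> F" for x using a(2) that by (meson INF_lower order_less_le_trans)
    then obtain T where T: "finite T" "T \<subseteq> D" "\<And>x. x \<in> F \<Longrightarrow> \<exists>\<theta>\<in>T. a < \<theta> \<bullet> x - \<Lambda> \<theta>"
      using finite_halfspace_cover[OF F] by blast
    have "\<forall>\<^sub>F n in sequentially. \<forall>\<theta>\<in>T. mgf n \<theta> \<le> exp (real n * (\<Lambda> \<theta> + (a - r)))"
      using T a by (intro eventually_ball_finite ballI mgf_eventually_le) auto
    then have "\<forall>\<^sub>F n in sequentially. prob {\<omega> \<in> space M. V n \<omega> \<in> F} \<le> (real (card T) + 1) * exp (- (real n * r))"
      using eventually_ge_at_top[of 1]
    proof eventually_elim
      case (elim n)
      note [measurable] = V_measurable[OF elim(2)]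
      have "prob {\<omega> \<in> space M. V n \<omega> \<in> F} \<le> prob (\<Union>\<theta>\<in>T. {\<omega> \<in> space M. a + \<Lambda> \<theta> < \<theta> \<bullet> V n \<omega>})"
        using T by (intro finite_measure_mono) (fastforce simp: algebra_simps)+
      also have "\<dots> \<le> (\<Sum>\<theta>\<in>T. prob {\<omega> \<in> space M. a + \<Lambda> \<theta> < \<theta> \<bullet> V n \<omega>})"
        using T by (intro finite_measure_subadditive_finite) auto
      also have "\<dots> \<le> (\<Sum>\<theta>\<in>T. exp (- (real n * r)))"
      proof (rule sum_mono)
        fix \<theta> assume \<theta>: "\<theta> \<in> T"
        have "prob {\<omega> \<in> space M. a + \<Lambda> \<theta> < \<theta> \<bullet> V n \<omega>} \<le> exp (- (real n * (a + \<Lambda> \<theta>))) * mgf n \<theta>"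
          using \<theta> T elim by (intro prob_halfspace_le) auto
        also have "\<dots> \<le> exp (- (real n * (a + \<Lambda> \<theta>))) * exp (real n * (\<Lambda> \<theta> + (a - r)))"
          using elim \<theta> by simp
        also have "\<dots> = exp (- (real n * r))" by (simp add: mult_exp_exp algebra_simps)
        finally show "prob {\<omega> \<in> space M. a + \<Lambda> \<theta> < \<theta> \<bullet> V n \<omega>} \<le> exp (- (real n * r))" .
      qed
      also have "\<dots> \<le> (real (card T) + 1) * exp (- (real n * r))" by (simp add: algebra_simps)
      finally show ?case .
    qed
    then show ?thesis by (rule limsup_log_prob_le) auto
  qed
  show ?thesis
  proof (rule ccontr)
    assume "\<not> ?thesis"
    then have "- ?S < ?I" by (simp add: not_le ereal_uminus_less_reorder)
    then obtain r where "- ?S < ereal r" "ereal r < ?I" using ereal_dense2 by blast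
    then have "ereal (- r) < ?S" "?S \<le> ereal (- r)"
      using key[of r] by (simp_all add: ereal_uminus_less_reorder)
    then show False by simp
  qed
qed

lemma liminf_log_prob_ge:
  assumes P: "\<forall>\<^sub>F n in sequentially. P n \<ge> C * exp (real n * r)" and C: "C > 0"
  shows "liminf (\<lambda>n. ereal (1 / real n) * log_prob (P n)) \<ge> ereal r"
proof -
  have "ereal r = liminf (\<lambda>n. ereal (ln C / real n + r))"
  proof (rule lim_imp_Liminf[symmetric])
    have "(\<lambda>n. ln C / real n + r) \<longlonglongrightarrow> 0 + r"
      by (intro tendsto_intros lim_const_over_n)
    then show "(\<lambda>n. ereal (ln C / real n + r)) \<longlonglongrightarrow> ereal r" by simp
  qed simp
  also have "\<dots> \<le> liminf (\<lambda>n. ereal (1 / real n) * log_prob (P n))"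
  proof (rule Liminf_mono)
    show "\<forall>\<^sub>F n in sequentially. ereal (ln C / real n + r) \<le> ereal (1 / real n) * log_prob (P n)"
      using P eventually_ge_at_top[of 1]
    proof eventually_elim
      case (elim n)
      have pos: "C * exp (real n * r) > 0" using C by simp
      have "ln C + real n * r = ln (C * exp (real n * r))" using C by (simp add: ln_mult)
      also have "\<dots> \<le> ln (P n)" using elim pos by (subst ln_le_cancel_iff) auto
      finally have "(ln C + real n * r) / real n \<le> ln (P n) / real n"
        by (rule divide_right_mono) simp
      moreover have "P n \<noteq> 0" using elim pos by auto
      ultimately show ?case using elim(2) by (simp add: log_prob_def add_divide_distrib)
    qed
  qed
  finally show ?thesis .
qed

text \<open>
  The derivative is used only in finitely many directions, so a single step length \<open>h\<close> serves them all.
\<close>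

lemma gradient_step:
  assumes \<theta>: "\<theta> \<in> D" and der: "(\<Lambda> has_derivative (\<lambda>h. x \<bullet> h)) (at \<theta>)" and e: "\<eta> > 0" and U: "finite U"
  obtains h where "h > 0" "\<And>u. u \<in> U \<Longrightarrow> \<theta> + h *\<^sub>R u \<in> D"
    "\<And>u. u \<in> U \<Longrightarrow> \<Lambda> (\<theta> + h *\<^sub>R u) < \<Lambda> \<theta> + h * (x \<bullet> u + \<eta>)"
proof -
  have "\<forall>\<^sub>F h in at_right 0. \<theta> + h *\<^sub>R u \<in> D \<and> \<Lambda> (\<theta> + h *\<^sub>R u) < \<Lambda> \<theta> + h * (x \<bullet> u + \<eta>)" for u
  proof -
    have "((\<lambda>h. \<theta> + h *\<^sub>R u) has_derivative (\<lambda>h. h *\<^sub>R u)) (at (0::real))"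
      by (auto intro!: derivative_eq_intros)
    moreover have "(\<Lambda> has_derivative (\<lambda>h. x \<bullet> h)) (at (\<theta> + 0 *\<^sub>R u))" using der by simp
    ultimately have "((\<lambda>h. \<Lambda> (\<theta> + h *\<^sub>R u)) has_derivative (\<lambda>h. x \<bullet> (h *\<^sub>R u))) (at (0::real))"
      by (rule has_derivative_compose)
    then have "((\<lambda>h. \<Lambda> (\<theta> + h *\<^sub>R u)) has_real_derivative (x \<bullet> u)) (at 0)"
      by (simp add: has_field_derivative_def mult_commute_abs)
    then have "((\<lambda>h. (\<Lambda> (\<theta> + h *\<^sub>R u) - \<Lambda> \<theta>) / h) \<longlongrightarrow> x \<bullet> u) (at 0)"
      by (simp add: DERIV_def)
    then have "((\<lambda>h. (\<Lambda> (\<theta> + h *\<^sub>R u) - \<Lambda> \<theta>) / h) \<longlongrightarrow> x \<bullet> u) (at_right 0)"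
      by (simp add: filterlim_at_split)
    then have 1: "\<forall>\<^sub>F h in at_right 0. (\<Lambda> (\<theta> + h *\<^sub>R u) - \<Lambda> \<theta>) / h < x \<bullet> u + \<eta>"
      using e by (auto elim: order_tendstoD(2))
    have "((\<lambda>h. \<theta> + h *\<^sub>R u) \<longlongrightarrow> \<theta> + 0 *\<^sub>R u) (at_right 0)"
      by (intro tendsto_intros)
    then have 2: "\<forall>\<^sub>F h in at_right 0. \<theta> + h *\<^sub>R u \<in> D"
      using open_D \<theta> by (auto elim: topological_tendstoD)
    have 3: "\<forall>\<^sub>F h::real in at_right 0. h > 0" by (simp add: eventually_at_right_less)
    from 1 2 3 show ?thesis by eventually_elim (simp add: field_simps)
  qed
  then have "\<forall>\<^sub>F h in at_right 0. \<forall>u\<in>U. \<theta> + h *\<^sub>R u \<in> D \<and> \<Lambda> (\<theta> + h *\<^sub>R u) < \<Lambda> \<theta> + h * (x \<bullet> u + \<eta>)"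
    using U by (intro eventually_ball_finite) auto
  then have "\<forall>\<^sub>F h in at_right 0. h > 0 \<and> (\<forall>u\<in>U. \<theta> + h *\<^sub>R u \<in> D \<and> \<Lambda> (\<theta> + h *\<^sub>R u) < \<Lambda> \<theta> + h * (x \<bullet> u + \<eta>))"
    by (intro eventually_conj) (simp add: eventually_at_right_less)
  then obtain h :: real where "h > 0" "\<forall>u\<in>U. \<theta> + h *\<^sub>R u \<in> D \<and> \<Lambda> (\<theta> + h *\<^sub>R u) < \<Lambda> \<theta> + h * (x \<bullet> u + \<eta>)"
    using eventually_happens'[OF trivial_limit_at_right_real] by blast
  then show ?thesis using that by blast
qed

text \<open>
  Cramer's exponential tilting without a change of measure. If \<open>x\<close> is the gradient of \<open>\<Lambda>\<close> at \<open>\<theta>\<close>, the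
  weight \<open>exp (n \<theta> \<bullet> V n)\<close> concentrates where \<open>V n\<close> is close to \<open>x\<close>: the part of it with
  \<open>u \<bullet> (V n - x) \<ge> \<eta>\<close> for some \<open>u = \<plusminus>\<close> basis vector is bounded, by Markov's inequality with the
  additional tilt \<open>h u\<close>, by a quantity that grows at rate at most
  \<open>\<Lambda> (\<theta> + h u) - h (x \<bullet> u + \<eta>)\<close>, and this is less than \<open>\<Lambda> \<theta>\<close> for small \<open>h\<close>.
\<close>

lemma liminf_at_gradient:
  assumes G: "open G" and x: "x \<in> G" and \<theta>: "\<theta> \<in> D" and der: "(\<Lambda> has_derivative (\<lambda>h. x \<bullet> h)) (at \<theta>)"
    and \<delta>: "\<delta> > 0"
  shows "\<exists>C>0. \<forall>\<^sub>F n in sequentially. prob {\<omega> \<in> space M. V n \<omega> \<in> G} \<ge> C * exp (real n * (\<Lambda> \<theta> - \<theta> \<bullet> x - \<delta>))"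
proof -
  define U :: "'b set" where "U = Basis \<union> uminus ` Basis"
  have U: "finite U" by (simp add: U_def)
  obtain e where e: "e > 0" "ball x e \<subseteq> G" using G x by (meson openE)
  \<comment> \<open>The box of side \<open>\<eta>\<close> around \<open>x\<close> must lie in \<open>G\<close>, and \<open>\<theta> \<bullet> (y - x)\<close> must cost at most half of \<open>\<delta>\<close> on it.\<close>
  define d where "d = min e (\<delta> / (2 * (norm \<theta> + 1)))"
  define \<eta> where "\<eta> = d / (2 * real DIM('b))"
  have d: "d > 0" "d \<le> e" "norm \<theta> * d \<le> \<delta> / 2"
  proof -
    show "d > 0" using e \<delta> by (simp add: d_def add_nonneg_pos)
    show "d \<le> e" by (simp add: d_def)
    have "norm \<theta> * d \<le> (norm \<theta> + 1) * (\<delta> / (2 * (norm \<theta> + 1)))"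
      using \<open>d > 0\<close> \<delta> by (intro mult_mono) (auto simp: d_def)
    also have "norm \<theta> + 1 > 0" by (simp add: add_nonneg_pos)
    then have "(norm \<theta> + 1) * (\<delta> / (2 * (norm \<theta> + 1))) = \<delta> / 2" by (simp add: divide_simps)
    finally show "norm \<theta> * d \<le> \<delta> / 2" .
  qed
  have \<eta>: "\<eta> > 0" using d by (simp add: \<eta>_def)
  have near: "norm (y - x) < d" if "\<And>u. u \<in> U \<Longrightarrow> u \<bullet> (y - x) < \<eta>" for y
  proof -
    have "norm (y - x) \<le> (\<Sum>i\<in>Basis. \<bar>(y - x) \<bullet> i\<bar>)" by (rule norm_le_l1)
    also have "\<dots> \<le> (\<Sum>i\<in>(Basis::'b set). \<eta>)"
    proof (rule sum_mono)
      fix i :: 'b assume "i \<in> Basis"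
      then have "i \<bullet> (y - x) < \<eta>" "(- i) \<bullet> (y - x) < \<eta>" by (intro that; simp add: U_def)+
      then show "\<bar>(y - x) \<bullet> i\<bar> \<le> \<eta>" unfolding inner_minus_left inner_commute[of "y - x"] by linarith
    qed
    also have "\<dots> = d / 2" by (simp add: \<eta>_def)
    finally show ?thesis using d by simp
  qed
  obtain h where h: "h > 0" "\<And>u. u \<in> U \<Longrightarrow> \<theta> + h *\<^sub>R u \<in> D"
    "\<And>u. u \<in> U \<Longrightarrow> \<Lambda> (\<theta> + h *\<^sub>R u) < \<Lambda> \<theta> + h * (x \<bullet> u + \<eta> / 4)"
    using gradient_step[OF \<theta> der, of "\<eta> / 4" U] \<eta> U by auto
  \<comment> \<open>\<open>\<zeta>\<close> is the allowed loss in the total tilted mass: small enough to keep it above the part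
    far from \<open>x\<close>, and to stay within the other half of \<open>\<delta>\<close>.\<close>
  define \<zeta> where "\<zeta> = min (h * \<eta> / 4) (\<delta> / 2)"
  have \<zeta>: "\<zeta> > 0" "\<zeta> \<le> h * \<eta> / 4" "\<zeta> \<le> \<delta> / 2" using h \<eta> \<delta> by (auto simp: \<zeta>_def)
  have lower: "\<forall>\<^sub>F n in sequentially. exp (real n * (\<Lambda> \<theta> - \<zeta>)) \<le> mgf n \<theta>"
    using \<theta> \<zeta> by (intro mgf_eventually_ge) auto
  have upper: "\<forall>\<^sub>F n in sequentially. \<forall>u\<in>U. mgf n (\<theta> + h *\<^sub>R u) \<le> exp (real n * (\<Lambda> \<theta> + h * (x \<bullet> u + \<eta> / 4) ))"
    using U h by (intro eventually_ball_finite ballI mgf_eventually_le) auto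
  have "(\<lambda>n. exp (- (h * \<eta> / 2)) ^ n) \<longlonglongrightarrow> 0"
    using h \<eta> by (intro LIMSEQ_power_zero) auto
  then have "\<forall>\<^sub>F n in sequentially. exp (- (h * \<eta> / 2)) ^ n < 1 / (2 * (real (card U) + 1))"
    by (rule order_tendstoD) (simp add: add_nonneg_pos)
  then have small: "\<forall>\<^sub>F n in sequentially. real (card U) * exp (real n * (- (h * \<eta> / 2))) \<le> 1 / 2"
  proof eventually_elim
    case (elim n)
    then have "(real (card U) + 1) * exp (real n * (- (h * \<eta> / 2))) \<le> 1 / 2"
      unfolding exp_of_nat_mult by (simp add: field_simps)
    then show ?case by (smt (verit) exp_gt_zero mult_less_cancel_right)
  qed
  have "\<forall>\<^sub>F n in sequentially. prob {\<omega> \<in> space M. V n \<omega> \<in> G} \<ge> (1/2) * exp (real n * (\<Lambda> \<theta> - \<theta> \<bullet> x - \<delta>))"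
    using lower upper small eventually_ge_at_top[of 1]
  proof eventually_elim
    case (elim n)
    note [measurable] = V_measurable[OF elim(4)]
    define E where "E = {\<omega> \<in> space M. V n \<omega> \<in> G}"
    have [measurable]: "E \<in> sets M" unfolding E_def using measurable_sets[OF V_measurable[OF elim(4)], of G] G
      by (simp add: vimage_def Int_def conj_commute)
    define f where "f = (\<lambda>\<omega>. exp (real n * (\<theta> \<bullet> V n \<omega>)))"
    define g where "g = (\<lambda>u \<omega>. exp (- (real n * (h * (x \<bullet> u + \<eta>)))) * exp (real n * ((\<theta> + h *\<^sub>R u) \<bullet> V n \<omega>)))"
    have int_f: "integrable M f" unfolding f_def using \<theta> elim by (intro integrable_exp)
    have int_g: "integrable M (g u)" if "u \<in> U" for u
      unfolding g_def using that elim h by (intro integrable_mult_right integrable_exp) auto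
    have int_E: "integrable M (indicator E :: _ \<Rightarrow> real)" by (simp add: less_top[symmetric])
    have pt: "f \<omega> - (\<Sum>u\<in>U. g u \<omega>) \<le> exp (real n * (\<theta> \<bullet> x + \<delta> / 2)) * indicator E \<omega>" if \<omega>: "\<omega> \<in> space M" for \<omega>
    proof (cases "\<forall>u\<in>U. u \<bullet> (V n \<omega> - x) < \<eta>")
      case True
      then have nr: "norm (V n \<omega> - x) < d" using near by blast
      then have "V n \<omega> \<in> G" using e d by (intro subsetD[OF e(2)]) (simp add: dist_norm norm_minus_commute)
      then have E: "\<omega> \<in> E" using \<omega> by (simp add: E_def)
      have "\<theta> \<bullet> (V n \<omega> - x) \<le> norm \<theta> * norm (V n \<omega> - x)" by (rule norm_cauchy_schwarz)
      also have "\<dots> \<le> norm \<theta> * d" using nr by (intro mult_left_mono) auto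
      also have "\<dots> \<le> \<delta> / 2" by (rule d)
      finally have "\<theta> \<bullet> V n \<omega> \<le> \<theta> \<bullet> x + \<delta> / 2" by (simp add: inner_diff_right)
      then have "f \<omega> \<le> exp (real n * (\<theta> \<bullet> x + \<delta> / 2))" by (simp add: f_def mult_left_mono)
      moreover have "(\<Sum>u\<in>U. g u \<omega>) \<ge> 0" by (intro sum_nonneg) (simp add: g_def)
      ultimately show ?thesis using E by simp
    next
      case False
      then obtain u where u: "u \<in> U" "u \<bullet> (V n \<omega> - x) \<ge> \<eta>" by (auto simp: not_less)
      have "h * (x \<bullet> u + \<eta>) \<le> h * (u \<bullet> V n \<omega>)"
        using u h by (intro mult_left_mono) (auto simp: inner_diff_right inner_commute)
      then have "\<theta> \<bullet> V n \<omega> \<le> (\<theta> + h *\<^sub>R u) \<bullet> V n \<omega> - h * (x \<bullet> u + \<eta>)"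
        by (simp add: inner_add_left)
      then have "real n * (\<theta> \<bullet> V n \<omega>) \<le> real n * ((\<theta> + h *\<^sub>R u) \<bullet> V n \<omega> - h * (x \<bullet> u + \<eta>))"
        by (intro mult_left_mono) auto
      then have "f \<omega> \<le> g u \<omega>" by (simp add: f_def g_def mult_exp_exp right_diff_distrib)
      also have "\<dots> \<le> (\<Sum>u\<in>U. g u \<omega>)" using u U by (intro member_le_sum) (auto simp: g_def)
      finally have "f \<omega> - (\<Sum>u\<in>U. g u \<omega>) \<le> 0" by simp
      also have "0 \<le> exp (real n * (\<theta> \<bullet> x + \<delta> / 2)) * indicator E \<omega>" by simp
      finally show ?thesis .
    qed
    have "expectation (\<lambda>\<omega>. f \<omega> - (\<Sum>u\<in>U. g u \<omega>)) \<le> expectation (\<lambda>\<omega>. exp (real n * (\<theta> \<bullet> x + \<delta> / 2)) * indicator E \<omega>)"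
      using pt int_f int_g int_E by (intro integral_mono Bochner_Integration.integrable_diff Bochner_Integration.integrable_sum integrable_mult_right) auto
    also have "\<dots> = exp (real n * (\<theta> \<bullet> x + \<delta> / 2)) * prob E" by simp
    also have "expectation (\<lambda>\<omega>. f \<omega> - (\<Sum>u\<in>U. g u \<omega>)) = mgf n \<theta> - (\<Sum>u\<in>U. exp (- (real n * (h * (x \<bullet> u + \<eta>)))) * mgf n (\<theta> + h *\<^sub>R u))"
      using int_f int_g by (subst Bochner_Integration.integral_diff)
        (auto simp: f_def g_def mgf_def intro!: Bochner_Integration.integrable_sum sum.cong)
    finally have 1: "mgf n \<theta> - (\<Sum>u\<in>U. exp (- (real n * (h * (x \<bullet> u + \<eta>)))) * mgf n (\<theta> + h *\<^sub>R u)) \<le> exp (real n * (\<theta> \<bullet> x + \<delta> / 2)) * prob E" .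
    have "(\<Sum>u\<in>U. exp (- (real n * (h * (x \<bullet> u + \<eta>)))) * mgf n (\<theta> + h *\<^sub>R u)) \<le> (\<Sum>u\<in>U. exp (real n * (\<Lambda> \<theta> - \<zeta>)) * exp (real n * (- (h * \<eta> / 2))))"
    proof (rule sum_mono)
      fix u assume u: "u \<in> U"
      have "exp (- (real n * (h * (x \<bullet> u + \<eta>)))) * mgf n (\<theta> + h *\<^sub>R u)
        \<le> exp (- (real n * (h * (x \<bullet> u + \<eta>)))) * exp (real n * (\<Lambda> \<theta> + h * (x \<bullet> u + \<eta> / 4)))"
        using elim u by (intro mult_left_mono) auto
      also have "\<dots> = exp (real n * (\<Lambda> \<theta> - 3 * (h * \<eta>) / 4))"
        by (simp add: mult_exp_exp algebra_simps)
      also have "\<dots> \<le> exp (real n * (\<Lambda> \<theta> - \<zeta> - h * \<eta> / 2))"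
        using \<zeta> by (subst exp_le_cancel_iff, intro mult_left_mono) auto
      also have "\<dots> = exp (real n * (\<Lambda> \<theta> - \<zeta>)) * exp (real n * (- (h * \<eta> / 2)))"
        by (simp add: mult_exp_exp algebra_simps)
      finally show "exp (- (real n * (h * (x \<bullet> u + \<eta>)))) * mgf n (\<theta> + h *\<^sub>R u) \<le> exp (real n * (\<Lambda> \<theta> - \<zeta>)) * exp (real n * (- (h * \<eta> / 2)))" .
    qed
    also have "\<dots> = exp (real n * (\<Lambda> \<theta> - \<zeta>)) * (real (card U) * exp (real n * (- (h * \<eta> / 2))))"
      by simp
    also have "\<dots> \<le> exp (real n * (\<Lambda> \<theta> - \<zeta>)) * (1 / 2)"
      using elim by (intro mult_left_mono) auto
    finally have "(1/2) * exp (real n * (\<Lambda> \<theta> - \<zeta>)) \<le> exp (real n * (\<theta> \<bullet> x + \<delta> / 2)) * prob E"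
      using 1 elim by linarith
    then have "exp (- (real n * (\<theta> \<bullet> x + \<delta> / 2))) * ((1/2) * exp (real n * (\<Lambda> \<theta> - \<zeta>)))
       \<le> exp (- (real n * (\<theta> \<bullet> x + \<delta> / 2))) * (exp (real n * (\<theta> \<bullet> x + \<delta> / 2)) * prob E)"
      by (intro mult_left_mono) auto
    also have "\<dots> = prob E" by (simp add: exp_minus)
    also have "exp (- (real n * (\<theta> \<bullet> x + \<delta> / 2))) * ((1/2) * exp (real n * (\<Lambda> \<theta> - \<zeta>)))
       = (1/2) * exp (real n * (\<Lambda> \<theta> - \<theta> \<bullet> x - \<delta> / 2 - \<zeta>))"
      by (simp add: mult_exp_exp algebra_simps)
    finally have 2: "(1/2) * exp (real n * (\<Lambda> \<theta> - \<theta> \<bullet> x - \<delta> / 2 - \<zeta>)) \<le> prob E" .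
    have "real n * (\<Lambda> \<theta> - \<theta> \<bullet> x - \<delta>) \<le> real n * (\<Lambda> \<theta> - \<theta> \<bullet> x - \<delta> / 2 - \<zeta>)"
      using \<zeta> by (intro mult_left_mono) auto
    then have "exp (real n * (\<Lambda> \<theta> - \<theta> \<bullet> x - \<delta>)) \<le> exp (real n * (\<Lambda> \<theta> - \<theta> \<bullet> x - \<delta> / 2 - \<zeta>))"
      by simp
    with 2 show ?case unfolding E_def by linarith
  qed
  then show ?thesis by (intro exI[of _ "1/2"]) auto
qed

text \<open>
  In the usual Gartner-Ellis theorem essential smoothness is what makes every relevant point a gradient;
  here this is assumed directly, since in the application the dual parameter is explicit.
\<close>

theorem LDP_if_rate_points_are_gradients:
  assumes grad: "\<And>x. rate x < \<infinity> \<Longrightarrow> \<exists>\<theta>\<in>D. (\<Lambda> has_derivative (\<lambda>h. x \<bullet> h)) (at \<theta>)"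
  shows "satisfies_LDP M V rate"
  unfolding satisfies_LDP_def
proof (intro conjI allI impI)
  fix G :: "'b set" assume G: "open G"
  let ?L = "liminf (\<lambda>n. ereal (1 / real n) * log_prob (prob {\<omega> \<in> space M. V n \<omega> \<in> G}))"
  have "- ?L \<le> rate x" if x: "x \<in> G" for x
  proof (cases "rate x < \<infinity>")
    case True
    then obtain \<theta> where \<theta>: "\<theta> \<in> D" "(\<Lambda> has_derivative (\<lambda>h. x \<bullet> h)) (at \<theta>)" using grad by blast
    have "ereal (\<Lambda> \<theta> - \<theta> \<bullet> x) \<le> ?L + ereal \<delta>" if "\<delta> > 0" for \<delta>
    proof -
      have "ereal (\<Lambda> \<theta> - \<theta> \<bullet> x - \<delta>) \<le> ?L"
        using liminf_at_gradient[OF G x \<theta> that] by (elim exE conjE) (rule liminf_log_prob_ge)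
      then have "ereal (\<Lambda> \<theta> - \<theta> \<bullet> x - \<delta>) + ereal \<delta> \<le> ?L + ereal \<delta>" by (intro add_mono) auto
      then show ?thesis by simp
    qed
    then have "ereal (\<Lambda> \<theta> - \<theta> \<bullet> x) \<le> ?L" by (rule ereal_le_epsilon2)
    then have "- ?L \<le> - ereal (\<Lambda> \<theta> - \<theta> \<bullet> x)"
      by (simp only: ereal_minus_le_minus)
    also have "\<dots> = ereal (\<theta> \<bullet> x - \<Lambda> \<theta>)" by simp
    also have "\<dots> \<le> rate x" using \<theta> by (intro rate_ge)
    finally show ?thesis .
  qed simp
  then have "- ?L \<le> (INF x\<in>G. rate x)" by (intro INF_greatest)
  then show "- (INF x\<in>G. rate x) \<le> ?L" by (simp only: ereal_uminus_le_reorder)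
qed (rule V_measurable rate_nonneg lower_semicontinuous_rate upper_bound, assumption?)+

end

section \<open>Exact moment generating function of the MA(1) process\<close>

abbreviation std_gaussian :: "real measure" where
  "std_gaussian \<equiv> density lborel (\<lambda>x. ennreal (std_normal_density x))"

lemma gaussian_exp_quadratic:
  fixes b d :: real
  assumes v: "1 - 2 * d > 0"
  shows "(\<integral>\<^sup>+x. ennreal (exp (a + b * x + d * x\<^sup>2)) \<partial>std_gaussian)
    = ennreal (exp (a + b\<^sup>2 / (2 * (1 - 2 * d)) - ln (1 - 2 * d) / 2))"
proof -
  define v where "v = 1 - 2 * d"
  have v0: "v > 0" using assms by (simp add: v_def)
  define K where "K = exp (a + b\<^sup>2 / (2 * v) - ln v / 2)"
  have eq: "std_normal_density x * exp (a + b * x + d * x\<^sup>2) = K * normal_density (b / v) (1 / sqrt v) x" for x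
  proof -
    have sv: "exp (- (ln v / 2)) = 1 / sqrt v"
      using v0 by (simp add: exp_minus powr_half_sqrt[symmetric] powr_def inverse_eq_divide)
    have d: "d = (1 - v) / 2" by (simp add: v_def)
    have e1: "- x\<^sup>2 / 2 + (a + b * x + d * x\<^sup>2) = (a + b\<^sup>2 / (2 * v)) + - (x - b / v)\<^sup>2 / (2 * (1 / sqrt v)\<^sup>2)"
      using v0 by (simp add: d power_divide power2_eq_square field_simps)
    have sq: "sqrt (2 * pi * (1 / sqrt v)\<^sup>2) = sqrt (2 * pi) * (1 / sqrt v)"
      using v0 by (simp add: real_sqrt_mult power_divide real_sqrt_divide)
    have "std_normal_density x * exp (a + b * x + d * x\<^sup>2) = 1 / sqrt (2 * pi) * exp (- x\<^sup>2 / 2 + (a + b * x + d * x\<^sup>2))"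
      by (simp add: std_normal_density_def mult_exp_exp)
    also have "\<dots> = 1 / sqrt (2 * pi) * exp (a + b\<^sup>2 / (2 * v)) * exp (- (x - b / v)\<^sup>2 / (2 * (1 / sqrt v)\<^sup>2))"
      unfolding e1 exp_add by simp
    also have "\<dots> = K * normal_density (b / v) (1 / sqrt v) x"
      unfolding K_def normal_density_def sq diff_conv_add_uminus[of _ "ln v / 2"] exp_add[of _ "- (ln v / 2)"] sv
      using v0 by simp
    finally show ?thesis .
  qed
  have "(\<integral>\<^sup>+x. ennreal (exp (a + b * x + d * x\<^sup>2)) \<partial>std_gaussian)
    = (\<integral>\<^sup>+x. ennreal (std_normal_density x * exp (a + b * x + d * x\<^sup>2)) \<partial>lborel)"
    by (subst nn_integral_density) (auto simp: ennreal_mult')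
  also have "\<dots> = (\<integral>\<^sup>+x. ennreal K * ennreal (normal_density (b / v) (1 / sqrt v) x) \<partial>lborel)"
    unfolding eq by (simp add: ennreal_mult' K_def)
  also have "\<dots> = ennreal K * (\<integral>\<^sup>+x. ennreal (normal_density (b / v) (1 / sqrt v) x) \<partial>lborel)"
    by (intro nn_integral_cmult) auto
  also have "(\<integral>\<^sup>+x. ennreal (normal_density (b / v) (1 / sqrt v) x) \<partial>lborel) = 1"
  proof -
    interpret prob_space "density lborel (normal_density (b / v) (1 / sqrt v))"
      using v0 by (intro prob_space_normal_density) auto
    show ?thesis using emeasure_space_1 by (simp add: emeasure_density)
  qed
  finally show ?thesis by (simp add: K_def v_def)
qed

text \<open>
  Integrating out \<open>\<epsilon> 0\<close>, \<open>\<epsilon> 1\<close>, \<dots> one after the other turns the exponential of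
  \<open>t \<Sum> Y + s \<Sum> Y\<^sup>2\<close> into the exponential of a quadratic polynomial in the last noise variable. The
  recursions below follow its coefficients. They are normalized so that \<open>ma1_prec\<close> is the precision of
  the Gaussian integral in the next step and \<open>ma1_lin\<close> is the coefficient of its linear term at \<open>Y = 0\<close>;
  in this form the recursion for the precision does not involve \<open>t\<close>.
\<close>

fun ma1_prec :: "real \<Rightarrow> real \<Rightarrow> nat \<Rightarrow> real" where
  "ma1_prec \<phi> s 0 = 1 - 2 * s * \<phi>\<^sup>2"
| "ma1_prec \<phi> s (Suc k) = 1 - 2 * s * (1 + \<phi>\<^sup>2) - 4 * s\<^sup>2 * \<phi>\<^sup>2 / ma1_prec \<phi> s k"

fun ma1_lin :: "real \<Rightarrow> real \<Rightarrow> real \<Rightarrow> nat \<Rightarrow> real" where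
  "ma1_lin \<phi> t s 0 = t * \<phi>"
| "ma1_lin \<phi> t s (Suc k) = t * (1 + \<phi>) + 2 * s * \<phi> / ma1_prec \<phi> s k * ma1_lin \<phi> t s k"

fun ma1_const :: "real \<Rightarrow> real \<Rightarrow> real \<Rightarrow> nat \<Rightarrow> real" where
  "ma1_const \<phi> t s 0 = 0"
| "ma1_const \<phi> t s (Suc k) = ma1_const \<phi> t s k
     + ((ma1_lin \<phi> t s k)\<^sup>2 / (2 * ma1_prec \<phi> s k) - ln (ma1_prec \<phi> s k) / 2)"

definition ma1_step :: "real \<Rightarrow> real \<Rightarrow> real \<Rightarrow> real \<Rightarrow> real \<Rightarrow> real" where
  "ma1_step \<phi> t s x y = exp (t * (y + \<phi> * x) + s * (y + \<phi> * x)\<^sup>2)"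

text \<open>
  The conditional exponential moment of the first \<open>k\<close> terms given \<open>\<epsilon> k = x\<close>.
\<close>

definition ma1_prefix :: "real \<Rightarrow> real \<Rightarrow> real \<Rightarrow> nat \<Rightarrow> real \<Rightarrow> real" where
  "ma1_prefix \<phi> t s k x = exp (ma1_const \<phi> t s k + (ma1_lin \<phi> t s k - t * \<phi>) * x
     + (1 - 2 * s * \<phi>\<^sup>2 - ma1_prec \<phi> s k) / 2 * x\<^sup>2)"

lemma ma1_prefix_measurable [measurable]: "ma1_prefix \<phi> t s k \<in> borel_measurable borel"
  unfolding ma1_prefix_def by measurable

lemma ma1_prefix_0: "ma1_prefix \<phi> t s 0 x = 1"
  by (simp add: ma1_prefix_def)

lemma ma1_prefix_Suc:
  assumes m: "ma1_prec \<phi> s k > 0"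
  shows "(\<integral>\<^sup>+x. ennreal (ma1_prefix \<phi> t s k x * ma1_step \<phi> t s x y) \<partial>std_gaussian) = ennreal (ma1_prefix \<phi> t s (Suc k) y)"
proof -
  define m where "m = ma1_prec \<phi> s k"
  define B where "B = ma1_lin \<phi> t s k"
  define a where "a = ma1_const \<phi> t s k"
  have m0: "m > 0" using assms by (simp add: m_def)
  have "(\<integral>\<^sup>+x. ennreal (ma1_prefix \<phi> t s k x * ma1_step \<phi> t s x y) \<partial>std_gaussian)
    = (\<integral>\<^sup>+x. ennreal (exp ((a + t * y + s * y\<^sup>2) + (B + 2 * s * \<phi> * y) * x + ((1 - m) / 2) * x\<^sup>2)) \<partial>std_gaussian)"
    unfolding ma1_prefix_def ma1_step_def mult_exp_exp m_def[symmetric] B_def[symmetric] a_def[symmetric]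
    by (intro nn_integral_cong arg_cong[where f=ennreal] arg_cong[where f=exp])
       (simp add: field_simps power2_eq_square)
  also have "\<dots> = ennreal (exp ((a + t * y + s * y\<^sup>2) + (B + 2 * s * \<phi> * y)\<^sup>2 / (2 * m) - ln m / 2))"
    using m0 gaussian_exp_quadratic[of "(1 - m) / 2" "a + t * y + s * y\<^sup>2" "B + 2 * s * \<phi> * y"]
    by (simp add: diff_divide_distrib)
  also have "(a + t * y + s * y\<^sup>2) + (B + 2 * s * \<phi> * y)\<^sup>2 / (2 * m) - ln m / 2
    = (a + (B\<^sup>2 / (2 * m) - ln m / 2)) + (t * (1 + \<phi>) + 2 * s * \<phi> / m * B - t * \<phi>) * y
     + (1 - 2 * s * \<phi>\<^sup>2 - (1 - 2 * s * (1 + \<phi>\<^sup>2) - 4 * s\<^sup>2 * \<phi>\<^sup>2 / m)) / 2 * y\<^sup>2"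
    using m0 by (simp add: field_simps power2_eq_square)
  also have "ennreal (exp \<dots>) = ennreal (ma1_prefix \<phi> t s (Suc k) y)"
    by (simp only: ma1_prefix_def m_def B_def a_def ma1_prec.simps ma1_lin.simps ma1_const.simps)
  finally show ?thesis .
qed

lemma borel_measurable_ma1_chain:
  fixes n :: nat
  assumes f: "\<And>i. i \<le> n \<Longrightarrow> (\<lambda>x. f x i) \<in> borel_measurable R"
  shows "(\<lambda>x. \<Prod>k=1..n. ma1_step \<phi> t s (f x (k - 1)) (f x k)) \<in> borel_measurable R"
proof (rule borel_measurable_prod)
  fix k assume "k \<in> {1..n}"
  then have k: "k \<le> n" by simp
  then have k': "k - 1 \<le> n" by linarith
  note [measurable] = f[OF k] f[OF k']
  show "(\<lambda>x. ma1_step \<phi> t s (f x (k - 1)) (f x k)) \<in> borel_measurable R"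
    unfolding ma1_step_def by measurable
qed

text \<open>
  The induction needs a test function \<open>g\<close> of the last variable, because the factor of the next step
  depends on it.
\<close>

lemma nn_integral_ma1_chain:
  fixes g :: "real \<Rightarrow> real"
  assumes pos: "\<And>k. ma1_prec \<phi> s k > 0" and [measurable]: "g \<in> borel_measurable borel" and g: "\<And>x. g x \<ge> 0"
  shows "(\<integral>\<^sup>+x. ennreal ((\<Prod>k=1..n. ma1_step \<phi> t s (x (k - 1)) (x k)) * g (x n)) \<partial>PiM {..n} (\<lambda>_. std_gaussian))
     = (\<integral>\<^sup>+x. ennreal (ma1_prefix \<phi> t s n x * g x) \<partial>std_gaussian)"
  using assms(2-)
proof (induction n arbitrary: g)
  case 0
  interpret N: prob_space std_gaussian by (rule prob_space_normal_density) simp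
  interpret product_sigma_finite "\<lambda>_::nat. std_gaussian" by standard
  note [measurable] = 0(1)
  have "(\<integral>\<^sup>+x. ennreal (g (x 0)) \<partial>PiM {0::nat} (\<lambda>_. std_gaussian)) = (\<integral>\<^sup>+x. ennreal (g x) \<partial>std_gaussian)"
    by (rule product_nn_integral_singleton) measurable
  moreover have "{..0::nat} = {0}" by auto
  ultimately show ?case by (simp add: ma1_prefix_0)
next
  case (Suc n)
  interpret N: prob_space std_gaussian by (rule prob_space_normal_density) simp
  interpret product_sigma_finite "\<lambda>_::nat. std_gaussian" by standard
  note [measurable] = Suc.prems(1)
  have coord: "(\<lambda>x. x i) \<in> borel_measurable (PiM {..Suc n} (\<lambda>_. std_gaussian))" if "i \<le> Suc n" for i
    using measurable_component_singleton[of i "{..Suc n}" "\<lambda>_. std_gaussian"] that by simp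
  have meas: "(\<lambda>x. ennreal ((\<Prod>k=1..Suc n. ma1_step \<phi> t s (x (k - 1)) (x k)) * g (x (Suc n))))
      \<in> borel_measurable (PiM {..Suc n} (\<lambda>_. std_gaussian))"
    by (intro measurable_compose[OF _ measurable_ennreal] borel_measurable_times borel_measurable_ma1_chain
          measurable_compose[OF coord Suc.prems(1)] coord) auto
  have ins: "{..Suc n} = insert (Suc n) {..n}" by auto
  have "(\<integral>\<^sup>+x. ennreal ((\<Prod>k=1..Suc n. ma1_step \<phi> t s (x (k - 1)) (x k)) * g (x (Suc n))) \<partial>PiM {..Suc n} (\<lambda>_. std_gaussian))
    = (\<integral>\<^sup>+y. (\<integral>\<^sup>+x. ennreal ((\<Prod>k=1..Suc n. ma1_step \<phi> t s ((x(Suc n := y)) (k - 1)) ((x(Suc n := y)) k)) * g ((x(Suc n := y)) (Suc n))) \<partial>PiM {..n} (\<lambda>_. std_gaussian)) \<partial>std_gaussian)"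
    unfolding ins
    by (rule product_nn_integral_insert_rev) (use meas in \<open>auto simp flip: ins simp del: prod.cl_ivl_Suc\<close>)
  also have "\<dots> = (\<integral>\<^sup>+y. (\<integral>\<^sup>+x. ennreal ((\<Prod>k=1..n. ma1_step \<phi> t s (x (k - 1)) (x k)) * (ma1_step \<phi> t s (x n) y * g y)) \<partial>PiM {..n} (\<lambda>_. std_gaussian)) \<partial>std_gaussian)"
  proof (intro nn_integral_cong)
    fix y x
    have "(\<Prod>k=1..n. ma1_step \<phi> t s ((x(Suc n := y)) (k - 1)) ((x(Suc n := y)) k)) = (\<Prod>k=1..n. ma1_step \<phi> t s (x (k - 1)) (x k))"
      by (intro prod.cong) auto
    then show "ennreal ((\<Prod>k=1..Suc n. ma1_step \<phi> t s ((x(Suc n := y)) (k - 1)) ((x(Suc n := y)) k)) * g ((x(Suc n := y)) (Suc n)))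
       = ennreal ((\<Prod>k=1..n. ma1_step \<phi> t s (x (k - 1)) (x k)) * (ma1_step \<phi> t s (x n) y * g y))"
      by (simp add: mult.assoc)
  qed
  also have "\<dots> = (\<integral>\<^sup>+y. (\<integral>\<^sup>+x. ennreal (ma1_prefix \<phi> t s n x * (ma1_step \<phi> t s x y * g y)) \<partial>std_gaussian) \<partial>std_gaussian)"
    using Suc.prems(2) by (intro nn_integral_cong Suc.IH) (auto simp: ma1_step_def)
  also have "\<dots> = (\<integral>\<^sup>+y. (\<integral>\<^sup>+x. ennreal (ma1_prefix \<phi> t s n x * ma1_step \<phi> t s x y) * ennreal (g y) \<partial>std_gaussian) \<partial>std_gaussian)"
    by (intro nn_integral_cong, subst ennreal_mult''[symmetric]) (simp_all add: Suc.prems(2) mult.assoc)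
  also have "\<dots> = (\<integral>\<^sup>+y. ennreal (ma1_prefix \<phi> t s (Suc n) y * g y) \<partial>std_gaussian)"
    using Suc.prems(2) ma1_prefix_Suc[OF pos]
    by (intro nn_integral_cong, subst nn_integral_multc) (auto simp: ennreal_mult'' ma1_step_def)
  finally show ?case .
qed

lemma (in prob_space) nn_integral_ma1:
  fixes \<epsilon> :: "nat \<Rightarrow> 'a \<Rightarrow> real"
  assumes ind: "indep_vars (\<lambda>_. borel) \<epsilon> UNIV"
    and dist: "\<And>n. distributed M lborel (\<epsilon> n) std_normal_density"
    and pos: "\<And>k. ma1_prec \<phi> s k > 0" "ma1_prec \<phi> s n + 2 * s * \<phi>\<^sup>2 > 0"
  shows "(\<integral>\<^sup>+\<omega>. ennreal (exp (t * (\<Sum>k=1..n. ma1 \<phi> \<epsilon> k \<omega>) + s * (\<Sum>k=1..n. (ma1 \<phi> \<epsilon> k \<omega>)\<^sup>2))) \<partial>M)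
    = ennreal (exp (ma1_const \<phi> t s n + ((ma1_lin \<phi> t s n - t * \<phi>)\<^sup>2 / (2 * (ma1_prec \<phi> s n + 2 * s * \<phi>\<^sup>2)) - ln (ma1_prec \<phi> s n + 2 * s * \<phi>\<^sup>2) / 2)))"
proof -
  have rv [measurable]: "\<epsilon> i \<in> borel_measurable M" for i
    using distributed_measurable[OF dist[of i]] by simp
  have distr: "distr M borel (\<epsilon> i) = std_gaussian" for i
    using distributed_distr_eq_density[OF dist[of i]] by (simp cong: distr_cong)
  have ind': "indep_vars (\<lambda>_. borel) \<epsilon> {..n}"
    by (rule indep_vars_subset[OF ind]) auto
  have D: "distr M (\<Pi>\<^sub>M i\<in>{..n}. borel) (\<lambda>\<omega>. \<lambda>i\<in>{..n}. \<epsilon> i \<omega>) = (\<Pi>\<^sub>M i\<in>{..n}. std_gaussian)"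
    using ind' by (subst (asm) indep_vars_iff_distr_eq_PiM') (auto simp: distr)
  define f where "f = (\<lambda>x::nat \<Rightarrow> real. \<Prod>k=1..n. ma1_step \<phi> t s (x (k - 1)) (x k))"
  have [measurable]: "f \<in> borel_measurable (\<Pi>\<^sub>M i\<in>{..n}. borel)"
    unfolding f_def by (rule borel_measurable_ma1_chain) measurable
  have "(\<integral>\<^sup>+\<omega>. ennreal (exp (t * (\<Sum>k=1..n. ma1 \<phi> \<epsilon> k \<omega>) + s * (\<Sum>k=1..n. (ma1 \<phi> \<epsilon> k \<omega>)\<^sup>2))) \<partial>M)
     = (\<integral>\<^sup>+\<omega>. ennreal (f (\<lambda>i\<in>{..n}. \<epsilon> i \<omega>)) \<partial>M)"
  proof (intro nn_integral_cong arg_cong[where f=ennreal])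
    fix \<omega>
    have "f (\<lambda>i\<in>{..n}. \<epsilon> i \<omega>) = (\<Prod>k=1..n. exp (t * ma1 \<phi> \<epsilon> k \<omega> + s * (ma1 \<phi> \<epsilon> k \<omega>)\<^sup>2))"
      unfolding f_def by (intro prod.cong) (auto simp: ma1_step_def ma1_def)
    then show "exp (t * (\<Sum>k=1..n. ma1 \<phi> \<epsilon> k \<omega>) + s * (\<Sum>k=1..n. (ma1 \<phi> \<epsilon> k \<omega>)\<^sup>2)) = f (\<lambda>i\<in>{..n}. \<epsilon> i \<omega>)"
      by (simp add: exp_sum[symmetric] sum.distrib sum_distrib_left)
  qed
  also have "\<dots> = (\<integral>\<^sup>+x. ennreal (f x) \<partial>distr M (\<Pi>\<^sub>M i\<in>{..n}. borel) (\<lambda>\<omega>. \<lambda>i\<in>{..n}. \<epsilon> i \<omega>))"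
    by (subst nn_integral_distr) auto
  also have "\<dots> = (\<integral>\<^sup>+x. ennreal (f x * 1) \<partial>PiM {..n} (\<lambda>_. std_gaussian))"
    unfolding D by simp
  also have "\<dots> = (\<integral>\<^sup>+x. ennreal (ma1_prefix \<phi> t s n x * 1) \<partial>std_gaussian)"
    unfolding f_def using pos(1) by (rule nn_integral_ma1_chain) auto
  also have "\<dots> = ennreal (exp (ma1_const \<phi> t s n + (ma1_lin \<phi> t s n - t * \<phi>)\<^sup>2 / (2 * (1 - 2 * ((1 - 2 * s * \<phi>\<^sup>2 - ma1_prec \<phi> s n) / 2))) - ln (1 - 2 * ((1 - 2 * s * \<phi>\<^sup>2 - ma1_prec \<phi> s n) / 2)) / 2))"
    unfolding ma1_prefix_def mult_1_right using pos(2) by (intro gaussian_exp_quadratic) (simp add: field_simps)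
  also have "1 - 2 * ((1 - 2 * s * \<phi>\<^sup>2 - ma1_prec \<phi> s n) / 2) = ma1_prec \<phi> s n + 2 * s * \<phi>\<^sup>2"
    by (simp add: field_simps)
  finally show ?thesis by (simp only: add_diff_eq)
qed

section \<open>Limit of the normalized logarithmic moment generating function\<close>

lemma tendsto_zero_if_contracting:
  fixes z e :: "nat \<Rightarrow> real"
  assumes z: "\<And>k. z k \<ge> 0" and step: "\<forall>\<^sub>F k in sequentially. z (Suc k) \<le> r * z k + e k"
    and r: "0 \<le> r" "r < 1" and e: "e \<longlonglongrightarrow> 0"
  shows "z \<longlonglongrightarrow> 0"
proof (rule LIMSEQ_I)
  fix \<epsilon> :: real assume \<epsilon>: "\<epsilon> > 0"
  have "\<forall>\<^sub>F k in sequentially. e k < (1 - r) * (\<epsilon> / 2)"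
    using e r \<epsilon> by (intro order_tendstoD(2)[OF e]) auto
  with step have "\<forall>\<^sub>F k in sequentially. z (Suc k) \<le> r * z k + (1 - r) * (\<epsilon> / 2)"
    by eventually_elim simp
  then obtain N where N: "\<And>k. k \<ge> N \<Longrightarrow> z (Suc k) \<le> r * z k + (1 - r) * (\<epsilon> / 2)"
    by (auto simp: eventually_sequentially)
  have bound: "z (N + j) \<le> \<epsilon> / 2 + r ^ j * z N" for j
  proof (induction j)
    case (Suc j)
    have "z (N + Suc j) \<le> r * z (N + j) + (1 - r) * (\<epsilon> / 2)" using N[of "N + j"] by simp
    also have "\<dots> \<le> r * (\<epsilon> / 2 + r ^ j * z N) + (1 - r) * (\<epsilon> / 2)"
      using Suc r by (intro add_mono mult_left_mono) auto
    also have "\<dots> = \<epsilon> / 2 + r ^ Suc j * z N" by (simp add: field_simps)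
    finally show ?case .
  qed (use \<epsilon> in simp)
  have "(\<lambda>j. r ^ j * z N) \<longlonglongrightarrow> 0 * z N" using r by (intro tendsto_intros LIMSEQ_power_zero) auto
  then have "\<forall>\<^sub>F j in sequentially. r ^ j * z N < \<epsilon> / 2"
    using \<epsilon> by (intro order_tendstoD(2)) auto
  then obtain J where J: "\<And>j. j \<ge> J \<Longrightarrow> r ^ j * z N < \<epsilon> / 2" by (auto simp: eventually_sequentially)
  show "\<exists>no. \<forall>n\<ge>no. norm (z n - 0) < \<epsilon>"
  proof (intro exI allI impI)
    fix n assume "n \<ge> N + J"
    then have "z (N + (n - N)) < \<epsilon>" using bound[of "n - N"] J[of "n - N"] by linarith
    moreover have "N + (n - N) = n" using \<open>n \<ge> N + J\<close> by simp
    ultimately show "norm (z n - 0) < \<epsilon>" using z[of n] by simp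
  qed
qed

lemma affine_recursion_tendsto:
  fixes x \<rho> :: "nat \<Rightarrow> real"
  assumes step: "\<And>k. x (Suc k) = u + \<rho> k * x k" and \<rho>: "\<rho> \<longlonglongrightarrow> l" and l: "\<bar>l\<bar> < 1"
  shows "x \<longlonglongrightarrow> u / (1 - l)"
proof -
  define L where "L = u / (1 - l)"
  have "u = L * (1 - l)" using l by (simp add: L_def)
  then have L: "u = L - l * L" by (simp add: algebra_simps)
  have "(\<lambda>k. \<bar>x k - L\<bar>) \<longlonglongrightarrow> 0"
  proof (rule tendsto_zero_if_contracting)
    have "\<forall>\<^sub>F k in sequentially. \<bar>\<rho> k\<bar> < (\<bar>l\<bar> + 1) / 2"
      using l by (intro order_tendstoD(2)[OF tendsto_rabs[OF \<rho>]]) auto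
    then show "\<forall>\<^sub>F k in sequentially. \<bar>x (Suc k) - L\<bar> \<le> ((\<bar>l\<bar> + 1) / 2) * \<bar>x k - L\<bar> + \<bar>\<rho> k - l\<bar> * \<bar>L\<bar>"
    proof eventually_elim
      case (elim k)
      have "x (Suc k) - L = \<rho> k * (x k - L) + (\<rho> k - l) * L"
        by (simp add: step L algebra_simps)
      also have "\<bar>\<dots>\<bar> \<le> \<bar>\<rho> k\<bar> * \<bar>x k - L\<bar> + \<bar>\<rho> k - l\<bar> * \<bar>L\<bar>"
        by (metis abs_mult abs_triangle_ineq)
      also have "\<dots> \<le> ((\<bar>l\<bar> + 1) / 2) * \<bar>x k - L\<bar> + \<bar>\<rho> k - l\<bar> * \<bar>L\<bar>"
        using elim by (intro add_mono mult_right_mono) auto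
      finally show ?case .
    qed
    have "(\<lambda>k. \<bar>\<rho> k - l\<bar> * \<bar>L\<bar>) \<longlonglongrightarrow> \<bar>l - l\<bar> * \<bar>L\<bar>"
      by (intro tendsto_intros \<rho>)
    then show "(\<lambda>k. \<bar>\<rho> k - l\<bar> * \<bar>L\<bar>) \<longlonglongrightarrow> 0" by simp
  qed (use l in auto)
  then have "(\<lambda>k. x k - L) \<longlonglongrightarrow> 0" by (simp only: tendsto_rabs_zero_iff)
  then show ?thesis unfolding L_def by (simp only: LIM_zero_iff)
qed

lemma average_tendsto_if_increments_tendsto:
  fixes a :: "nat \<Rightarrow> real"
  assumes inc: "(\<lambda>k. a (Suc k) - a k) \<longlonglongrightarrow> l"
  shows "(\<lambda>n. a n / real n) \<longlonglongrightarrow> l"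
proof (rule LIMSEQ_I)
  fix \<epsilon> :: real assume \<epsilon>: "\<epsilon> > 0"
  obtain N where N: "\<And>k. k \<ge> N \<Longrightarrow> \<bar>a (Suc k) - a k - l\<bar> < \<epsilon> / 2"
    using LIMSEQ_D[OF inc, of "\<epsilon> / 2"] \<epsilon> by auto
  define w where "w = (\<lambda>k. a k - real k * l)"
  have bound: "\<bar>w (N + j)\<bar> \<le> \<bar>w N\<bar> + real j * (\<epsilon> / 2)" for j
  proof (induction j)
    case (Suc j)
    have "w (N + Suc j) = w (N + j) + (a (Suc (N + j)) - a (N + j) - l)"
      by (simp add: w_def algebra_simps)
    moreover have "real (Suc j) * (\<epsilon> / 2) = real j * (\<epsilon> / 2) + \<epsilon> / 2" by (simp add: algebra_simps)
    ultimately show ?case using Suc N[of "N + j"] by linarith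
  qed simp
  obtain J where J: "real J * (\<epsilon> / 2) > \<bar>w N\<bar>"
    using reals_Archimedean3[of "\<epsilon> / 2"] \<epsilon> by auto
  show "\<exists>no. \<forall>n\<ge>no. norm (a n / real n - l) < \<epsilon>"
  proof (intro exI allI impI)
    fix n assume n: "n \<ge> N + J + 1"
    have "\<bar>w n\<bar> \<le> \<bar>w N\<bar> + real (n - N) * (\<epsilon> / 2)" using bound[of "n - N"] n by simp
    also have "\<dots> < real J * (\<epsilon> / 2) + real (n - N) * (\<epsilon> / 2)" using J by simp
    also have "\<dots> \<le> real n * (\<epsilon> / 2) + real n * (\<epsilon> / 2)"
      using n \<epsilon> by (intro add_mono mult_right_mono) auto
    finally have "\<bar>w n\<bar> < real n * \<epsilon>" by (simp add: mult.commute)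
    moreover have "a n / real n - l = w n / real n" using n by (simp add: w_def field_simps)
    ultimately show "norm (a n / real n - l) < \<epsilon>" using n by (simp add: abs_divide divide_less_eq mult.commute)
  qed
qed

text \<open>
  The precision follows the map \<open>m \<mapsto> \<kappa> + \<kappa>' - \<kappa> \<kappa>' / m\<close>, whose fixed points are
  \<open>\<kappa> = ((\<surd>p + \<surd>q) / 2)\<^sup>2\<close> and \<open>\<kappa>' = ((\<surd>p - \<surd>q) / 2)\<^sup>2\<close>. The start \<open>m0 = 1 - 2 s \<phi>\<^sup>2\<close> lies above the
  lower one: for \<open>s \<ge> 0\<close> because \<open>m0 = \<kappa> + \<kappa>' + 2 s\<close>, and for \<open>s < 0\<close> because
  \<open>(m0 - \<kappa>) (m0 - \<kappa>') = 2 s\<close> puts it between the two. So all iterates are at least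
  \<open>min m0 \<kappa> > \<kappa>'\<close>, and there the map contracts towards \<open>\<kappa>\<close>. The bound with
  \<open>2 s \<phi>\<^sup>2\<close> added serves the last integration, which has no factor coming from a following \<open>Y\<close>.
\<close>

lemma ma1_prec_bounds_and_limit:
  fixes \<phi> s :: real
  defines "p \<equiv> 1 - 2 * s * (1 + \<phi>)\<^sup>2" and "q \<equiv> 1 - 2 * s * (1 - \<phi>)\<^sup>2"
  defines "\<kappa> \<equiv> ((sqrt p + sqrt q) / 2)\<^sup>2"
  assumes pq: "p > 0" "q > 0"
  obtains \<mu> where "\<mu> > 0" "\<mu> + 2 * s * \<phi>\<^sup>2 > 0" "\<And>k. ma1_prec \<phi> s k \<ge> \<mu>" "ma1_prec \<phi> s \<longlonglongrightarrow> \<kappa>" "\<mu> \<le> \<kappa>"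
    "4 * s\<^sup>2 * \<phi>\<^sup>2 < \<kappa>\<^sup>2" "(\<kappa> - 2 * s * \<phi>)\<^sup>2 = \<kappa> * p"
proof -
  define \<kappa>' where "\<kappa>' = ((sqrt p - sqrt q) / 2)\<^sup>2"
  have sq: "(sqrt p)\<^sup>2 = p" "(sqrt q)\<^sup>2 = q" using pq by auto
  have sum_gen: "((x + y) / 2)\<^sup>2 + ((x - y) / 2)\<^sup>2 = (x\<^sup>2 + y\<^sup>2) / 2"
    and prod_gen: "((x + y) / 2)\<^sup>2 * ((x - y) / 2)\<^sup>2 = ((x\<^sup>2 - y\<^sup>2) / 4)\<^sup>2"
    and diff_gen: "((x + y) / 2)\<^sup>2 - ((x - y) / 2)\<^sup>2 = x * y" for x y :: real
    by (simp_all add: power2_eq_square field_simps)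
  have sp: "sqrt p > 0" "sqrt q > 0" using pq by auto
  have sum: "\<kappa> + \<kappa>' = 1 - 2 * s * (1 + \<phi>\<^sup>2)"
  proof -
    have "\<kappa> + \<kappa>' = (p + q) / 2" unfolding \<kappa>_def \<kappa>'_def by (simp only: sum_gen sq)
    also have "\<dots> = 1 - 2 * s * (1 + \<phi>\<^sup>2)" by (simp add: p_def q_def power2_eq_square field_simps)
    finally show ?thesis .
  qed
  have prod: "\<kappa> * \<kappa>' = 4 * s\<^sup>2 * \<phi>\<^sup>2"
  proof -
    have "\<kappa> * \<kappa>' = ((p - q) / 4)\<^sup>2" unfolding \<kappa>_def \<kappa>'_def by (simp only: prod_gen sq)
    also have "\<dots> = 4 * s\<^sup>2 * \<phi>\<^sup>2" by (simp add: p_def q_def power2_eq_square field_simps)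
    finally show ?thesis .
  qed
  have lt: "\<kappa>' < \<kappa>"
  proof -
    have "\<kappa> - \<kappa>' = sqrt p * sqrt q" unfolding \<kappa>_def \<kappa>'_def by (rule diff_gen)
    then show ?thesis using sp by (smt (verit) mult_pos_pos)
  qed
  have "(sqrt p + sqrt q) / 2 > 0" using add_pos_pos[OF sp] by simp
  then have \<kappa>: "\<kappa> > 0" unfolding \<kappa>_def by (rule zero_less_power)
  have \<kappa>': "\<kappa>' \<ge> 0" by (simp add: \<kappa>'_def)
  define m0 where "m0 = 1 - 2 * s * \<phi>\<^sup>2"
  have m0_quad: "(m0 - \<kappa>) * (m0 - \<kappa>') = 2 * s"
  proof -
    have "(m0 - \<kappa>) * (m0 - \<kappa>') = m0\<^sup>2 - (\<kappa> + \<kappa>') * m0 + \<kappa> * \<kappa>'" by algebra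
    also have "\<dots> = 2 * s" unfolding sum prod m0_def by (simp add: power2_eq_square algebra_simps)
    finally show ?thesis .
  qed
  have m0_sum: "m0 = \<kappa> + \<kappa>' + 2 * s" unfolding sum m0_def by (simp add: algebra_simps)
  define \<mu> where "\<mu> = min m0 \<kappa>"
  have \<mu>: "\<mu> > \<kappa>'" "\<mu> + 2 * s * \<phi>\<^sup>2 > 0"
  proof -
    consider "s \<ge> 0" | "s < 0" by linarith
    then have "\<mu> > \<kappa>' \<and> \<mu> + 2 * s * \<phi>\<^sup>2 > 0"
    proof cases
      case 1
      then have "m0 > \<kappa>'" using m0_sum \<kappa> by linarith
      then have "\<mu> > \<kappa>'" using lt by (simp add: \<mu>_def)
      then show ?thesis using 1 \<kappa>' by (smt (verit) mult_nonneg_nonneg zero_le_power2)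
    next
      case 2
      then have "(m0 - \<kappa>) * (m0 - \<kappa>') < 0" using m0_quad by simp
      then have "m0 < \<kappa>" "m0 > \<kappa>'" using lt by (auto simp: mult_less_0_iff)
      then show ?thesis by (simp add: \<mu>_def m0_def)
    qed
    then show "\<mu> > \<kappa>'" "\<mu> + 2 * s * \<phi>\<^sup>2 > 0" by auto
  qed
  have \<mu>0: "\<mu> > 0" using \<mu> \<kappa>' by simp
  have \<mu>\<kappa>: "\<mu> \<le> \<kappa>" by (simp add: \<mu>_def)
  have Suc_eq: "ma1_prec \<phi> s (Suc k) = \<kappa> + \<kappa>' - \<kappa> * \<kappa>' / ma1_prec \<phi> s k" for k
    by (simp add: sum prod)
  have ge: "ma1_prec \<phi> s k \<ge> \<mu>" for k
  proof (induction k)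
    case 0
    then show ?case by (simp add: \<mu>_def m0_def)
  next
    case (Suc k)
    have "\<kappa> * \<kappa>' / ma1_prec \<phi> s k \<le> \<kappa> * \<kappa>' / \<mu>"
      using Suc \<mu>0 \<kappa> \<kappa>' by (intro divide_left_mono mult_nonneg_nonneg mult_pos_pos) auto
    also have "\<dots> \<le> \<kappa> + \<kappa>' - \<mu>"
    proof -
      have "(\<kappa> - \<mu>) * (\<mu> - \<kappa>') \<ge> 0" using \<mu>\<kappa> \<mu> by simp
      then show ?thesis using \<mu>0 by (simp add: field_simps)
    qed
    finally show ?case unfolding Suc_eq by simp
  qed
  have lim: "ma1_prec \<phi> s \<longlonglongrightarrow> \<kappa>"
  proof -
    have "(\<lambda>k. \<bar>ma1_prec \<phi> s k - \<kappa>\<bar>) \<longlonglongrightarrow> 0"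
    proof (rule tendsto_zero_if_contracting)
      show "\<forall>\<^sub>F k in sequentially. \<bar>ma1_prec \<phi> s (Suc k) - \<kappa>\<bar> \<le> (\<kappa>' / \<mu>) * \<bar>ma1_prec \<phi> s k - \<kappa>\<bar> + 0"
      proof (intro always_eventually allI)
        fix k
        have m: "ma1_prec \<phi> s k > 0" using ge[of k] \<mu>0 by simp
        have "ma1_prec \<phi> s (Suc k) - \<kappa> = \<kappa>' / ma1_prec \<phi> s k * (ma1_prec \<phi> s k - \<kappa>)"
          unfolding Suc_eq using m by (simp add: field_simps)
        then have "\<bar>ma1_prec \<phi> s (Suc k) - \<kappa>\<bar> = \<kappa>' / ma1_prec \<phi> s k * \<bar>ma1_prec \<phi> s k - \<kappa>\<bar>"
          using m \<kappa>' by (simp add: abs_mult)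
        also have "\<dots> \<le> (\<kappa>' / \<mu>) * \<bar>ma1_prec \<phi> s k - \<kappa>\<bar>"
          using ge[of k] \<mu>0 \<kappa>' m by (intro mult_right_mono divide_left_mono) auto
        finally show "\<bar>ma1_prec \<phi> s (Suc k) - \<kappa>\<bar> \<le> (\<kappa>' / \<mu>) * \<bar>ma1_prec \<phi> s k - \<kappa>\<bar> + 0" by simp
      qed
    qed (use \<mu> \<mu>0 \<kappa>' in auto)
    then have "(\<lambda>k. ma1_prec \<phi> s k - \<kappa>) \<longlonglongrightarrow> 0" by (simp only: tendsto_rabs_zero_iff)
    then show ?thesis by (simp only: LIM_zero_iff)
  qed
  have "\<kappa> * \<kappa>' < \<kappa> * \<kappa>" using lt \<kappa> by simp
  then have 1: "4 * s\<^sup>2 * \<phi>\<^sup>2 < \<kappa>\<^sup>2" unfolding prod by (simp add: power2_eq_square)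
  have "(\<kappa> - 2 * s * \<phi>)\<^sup>2 = \<kappa>\<^sup>2 - 4 * s * \<phi> * \<kappa> + 4 * s\<^sup>2 * \<phi>\<^sup>2" by algebra
  also have "\<dots> = \<kappa> * (\<kappa> + \<kappa>' - 4 * s * \<phi>)" unfolding prod[symmetric] by algebra
  also have "\<kappa> + \<kappa>' - 4 * s * \<phi> = p" unfolding sum p_def by (simp add: power2_eq_square algebra_simps)
  finally have 2: "(\<kappa> - 2 * s * \<phi>)\<^sup>2 = \<kappa> * p" .
  show ?thesis by (rule that[OF \<mu>0 \<mu>(2) ge lim \<mu>\<kappa> 1 2])
qed

text \<open>
  Both conditions together say that \<open>2 s f < 1\<close> for the spectral density \<open>f\<close>, whose extreme values are
  \<open>(1 + \<phi>)\<^sup>2\<close> and \<open>(1 - \<phi>)\<^sup>2\<close>.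
\<close>

definition ma1_domain :: "real \<Rightarrow> (real \<times> real) set" where
  "ma1_domain \<phi> = {(t, s). 0 < 1 - 2 * s * (1 + \<phi>)\<^sup>2 \<and> 0 < 1 - 2 * s * (1 - \<phi>)\<^sup>2}"

text \<open>
  By Jensen's formula this is half the mean over the circle of
  \<open>log (1 - 2 s f)\<close>, where \<open>f \<theta> = |1 + \<phi> e\<^sup>i\<^sup>\<theta>|\<^sup>2\<close> is the spectral density of the process,
  that is, the Szego limit of half the normalized log-determinant of the identity minus \<open>2 s\<close>
  times the covariance matrix.
\<close>

definition half_mean_log :: "real \<Rightarrow> real \<Rightarrow> real" where
  "half_mean_log \<phi> s = ln ((sqrt (1 - 2 * s * (1 + \<phi>)\<^sup>2) + sqrt (1 - 2 * s * (1 - \<phi>)\<^sup>2)) / 2)"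

definition ma1_log_mgf :: "real \<Rightarrow> real \<times> real \<Rightarrow> real" where
  "ma1_log_mgf \<phi> = (\<lambda>(t, s).
     t\<^sup>2 * (1 + \<phi>)\<^sup>2 / (2 * (1 - 2 * s * (1 + \<phi>)\<^sup>2)) - half_mean_log \<phi> s)"

lemma ma1_const_average_tendsto:
  assumes ts: "(t, s) \<in> ma1_domain \<phi>"
  shows "(\<lambda>n. ma1_const \<phi> t s n / real n) \<longlonglongrightarrow> ma1_log_mgf \<phi> (t, s)" and "convergent (ma1_lin \<phi> t s)"
proof -
  define p where "p = 1 - 2 * s * (1 + \<phi>)\<^sup>2"
  define q where "q = 1 - 2 * s * (1 - \<phi>)\<^sup>2"
  define \<kappa> where "\<kappa> = ((sqrt p + sqrt q) / 2)\<^sup>2"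
  have pq: "p > 0" "q > 0" using ts by (auto simp: ma1_domain_def p_def q_def)
  obtain \<mu> where \<mu>: "\<mu> > 0" "\<And>k. ma1_prec \<phi> s k \<ge> \<mu>" "ma1_prec \<phi> s \<longlonglongrightarrow> \<kappa>" "\<mu> \<le> \<kappa>"
    "4 * s\<^sup>2 * \<phi>\<^sup>2 < \<kappa>\<^sup>2" "(\<kappa> - 2 * s * \<phi>)\<^sup>2 = \<kappa> * p"
    using ma1_prec_bounds_and_limit[of s \<phi>] pq unfolding p_def q_def \<kappa>_def by metis
  have \<kappa>: "\<kappa> > 0" using \<mu> by simp
  define B where "B = t * (1 + \<phi>) / (1 - 2 * s * \<phi> / \<kappa>)"
  have "(2 * s * \<phi>)\<^sup>2 < \<kappa>\<^sup>2" using \<mu>(5) by (simp add: power_mult_distrib)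
  then have "\<bar>2 * s * \<phi>\<bar> < \<kappa>" using \<kappa> by (metis abs_of_pos abs_square_le_1 power2_abs power2_less_imp_less less_imp_le)
  then have lt1: "\<bar>2 * s * \<phi> / \<kappa>\<bar> < 1" using \<kappa> by simp
  have lin: "ma1_lin \<phi> t s \<longlonglongrightarrow> B"
    unfolding B_def
  proof (rule affine_recursion_tendsto[OF _ _ lt1])
    show "(\<lambda>k. 2 * s * \<phi> / ma1_prec \<phi> s k) \<longlonglongrightarrow> 2 * s * \<phi> / \<kappa>"
      using \<kappa> by (intro tendsto_intros \<mu>) auto
  qed simp
  then show "convergent (ma1_lin \<phi> t s)" by (rule convergentI)
  have "(\<lambda>k. ma1_const \<phi> t s (Suc k) - ma1_const \<phi> t s k) \<longlonglongrightarrow> B\<^sup>2 / (2 * \<kappa>) - ln \<kappa> / 2"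
    using \<kappa> by (simp, intro tendsto_intros lin \<mu>) auto
  then have "(\<lambda>n. ma1_const \<phi> t s n / real n) \<longlonglongrightarrow> B\<^sup>2 / (2 * \<kappa>) - ln \<kappa> / 2"
    by (rule average_tendsto_if_increments_tendsto)
  moreover have "B\<^sup>2 / (2 * \<kappa>) = t\<^sup>2 * (1 + \<phi>)\<^sup>2 / (2 * p)"
  proof -
    have "\<kappa> - 2 * s * \<phi> > 0" using \<open>\<bar>2 * s * \<phi>\<bar> < \<kappa>\<close> by linarith
    have "B = t * (1 + \<phi>) * \<kappa> / (\<kappa> - 2 * s * \<phi>)"
      using \<kappa> \<open>\<kappa> - 2 * s * \<phi> > 0\<close> by (simp add: B_def field_simps)
    then have "B\<^sup>2 = (t * (1 + \<phi>) * \<kappa>)\<^sup>2 / (\<kappa> * p)"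
      by (simp add: power_divide \<mu>(6))
    also have "\<dots> = t\<^sup>2 * (1 + \<phi>)\<^sup>2 * \<kappa> / p"
      using \<kappa> by (simp add: power_mult_distrib power2_eq_square[of \<kappa>])
    finally show ?thesis using \<kappa> by simp
  qed
  moreover have "ln \<kappa> / 2 = ln ((sqrt p + sqrt q) / 2)"
  proof -
    have "(sqrt p + sqrt q) / 2 > 0" using pq by (simp add: add_pos_pos)
    then show ?thesis unfolding \<kappa>_def by (subst ln_realpow) auto
  qed
  ultimately show "(\<lambda>n. ma1_const \<phi> t s n / real n) \<longlonglongrightarrow> ma1_log_mgf \<phi> (t, s)"
    by (simp add: ma1_log_mgf_def half_mean_log_def p_def q_def)
qed

lemma inner_S_vec:
  assumes "n \<ge> 1"
  shows "real n * ((t, s) \<bullet> S_vec Y n \<omega>) = t * (\<Sum>k=1..n. Y k \<omega>) + s * (\<Sum>k=1..n. (Y k \<omega>)\<^sup>2)"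
  using assms by (simp add: S_vec_def inner_prod_def field_simps)

lemma (in prob_space) ma1_mgf:
  fixes \<epsilon> :: "nat \<Rightarrow> 'a \<Rightarrow> real"
  assumes ind: "indep_vars (\<lambda>_. borel) \<epsilon> UNIV"
    and dist: "\<And>n. distributed M lborel (\<epsilon> n) std_normal_density"
    and ts: "(t, s) \<in> ma1_domain \<phi>"
  shows "n \<ge> 1 \<Longrightarrow> integrable M (\<lambda>\<omega>. exp (real n * ((t, s) \<bullet> S_vec (ma1 \<phi> \<epsilon>) n \<omega>)))" (is "_ \<Longrightarrow> integrable M (?f n)")
    and "(\<lambda>n. ln (expectation (\<lambda>\<omega>. exp (real n * ((t, s) \<bullet> S_vec (ma1 \<phi> \<epsilon>) n \<omega>)))) / real n) \<longlonglongrightarrow> ma1_log_mgf \<phi> (t, s)"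
proof -
  obtain \<mu> \<kappa> where \<mu>: "\<mu> > 0" "\<mu> + 2 * s * \<phi>\<^sup>2 > 0" "\<And>k. ma1_prec \<phi> s k \<ge> \<mu>" "ma1_prec \<phi> s \<longlonglongrightarrow> \<kappa>" "\<mu> \<le> \<kappa>"
    using ma1_prec_bounds_and_limit[of s \<phi>] ts unfolding ma1_domain_def
    by (metis (no_types, lifting) case_prodD mem_Collect_eq)
  define v where "v = (\<lambda>n. ma1_prec \<phi> s n + 2 * s * \<phi>\<^sup>2)"
  define R where "R = (\<lambda>n. (ma1_lin \<phi> t s n - t * \<phi>)\<^sup>2 / (2 * v n) - ln (v n) / 2)"
  have pos: "ma1_prec \<phi> s k > 0" "v k > 0" for k using \<mu>(1,2) \<mu>(3)[of k] by (auto simp: v_def)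
  have [measurable]: "\<epsilon> i \<in> borel_measurable M" for i
    using distributed_measurable[OF dist[of i]] by simp
  have [measurable]: "?f n \<in> borel_measurable M" for n
    unfolding S_vec_def ma1_def by measurable
  have nn: "(\<integral>\<^sup>+\<omega>. ennreal (?f n \<omega>) \<partial>M) = ennreal (exp (ma1_const \<phi> t s n + R n))" if "n \<ge> 1" for n
    unfolding inner_S_vec[OF that] R_def v_def
    using pos by (intro nn_integral_ma1[OF ind dist]) (auto simp: v_def)
  have I: "has_bochner_integral M (?f n) (exp (ma1_const \<phi> t s n + R n))" if "n \<ge> 1" for n
    using nn[OF that] by (intro has_bochner_integral_nn_integral) auto
  then show "n \<ge> 1 \<Longrightarrow> integrable M (?f n)" by (auto simp: has_bochner_integral_iff)
  obtain B where B: "ma1_lin \<phi> t s \<longlonglongrightarrow> B"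
    using ma1_const_average_tendsto(2)[OF ts] by (auto simp: convergent_def)
  have "v \<longlonglongrightarrow> \<kappa> + 2 * s * \<phi>\<^sup>2" unfolding v_def by (intro tendsto_intros \<mu>)
  moreover have "\<kappa> + 2 * s * \<phi>\<^sup>2 > 0" using \<mu>(2,5) by simp
  ultimately have "R \<longlonglongrightarrow> (B - t * \<phi>)\<^sup>2 / (2 * (\<kappa> + 2 * s * \<phi>\<^sup>2)) - ln (\<kappa> + 2 * s * \<phi>\<^sup>2) / 2"
    unfolding R_def by (intro tendsto_intros B) auto
  then have "(\<lambda>n. R n / real n) \<longlonglongrightarrow> 0"
    by (rule real_tendsto_divide_at_top[OF _ filterlim_real_sequentially])
  then have "(\<lambda>n. ma1_const \<phi> t s n / real n + R n / real n) \<longlonglongrightarrow> ma1_log_mgf \<phi> (t, s) + 0"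
    by (intro tendsto_add ma1_const_average_tendsto(1)[OF ts])
  then have "(\<lambda>n. (ma1_const \<phi> t s n + R n) / real n) \<longlonglongrightarrow> ma1_log_mgf \<phi> (t, s)"
    by (simp add: add_divide_distrib)
  then show "(\<lambda>n. ln (expectation (?f n)) / real n) \<longlonglongrightarrow> ma1_log_mgf \<phi> (t, s)"
  proof (rule Lim_transform_eventually)
    show "\<forall>\<^sub>F n in sequentially. (ma1_const \<phi> t s n + R n) / real n = ln (expectation (?f n)) / real n"
      using eventually_ge_at_top[of 1]
      by eventually_elim (use I in \<open>simp add: has_bochner_integral_iff\<close>)
  qed
qed

section \<open>Trigonometric solution of a cubic with three real roots\<close>

text \<open>
  Two sign values suffice to locate the middle root: a positive value at \<open>u\<close> followed by a negative
  one at \<open>v > u\<close> is a descent, and a cubic with positive leading coefficient descends only around its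
  middle root.
\<close>

lemma cubic_middle_root:
  fixes a r1 r2 r3 u v :: real
  assumes a: "a > 0" and ord: "r1 \<le> r2" "r2 \<le> r3" and uv: "u < v"
    and u: "a * ((u - r1) * (u - r2) * (u - r3)) > 0"
    and v: "a * ((v - r1) * (v - r2) * (v - r3)) < 0"
  shows "u < r2" "r2 < v"
proof -
  have u': "(u - r1) * (u - r2) * (u - r3) > 0" using u a by (simp add: zero_less_mult_iff)
  have v': "(v - r1) * (v - r2) * (v - r3) < 0" using v a by (simp add: mult_less_0_iff)
  have u3: "u < r3"
  proof (rule ccontr)
    assume "\<not> u < r3"
    then have "(v - r1) * (v - r2) * (v - r3) \<ge> 0" using ord uv by (intro mult_nonneg_nonneg) auto
    then show False using v' by simp
  qed
  have v1: "r1 < v"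
  proof (rule ccontr)
    assume "\<not> r1 < v"
    then have "(u - r1) * (u - r2) * (u - r3) \<le> 0" using ord uv
      by (intro mult_nonneg_nonpos mult_nonpos_nonpos) auto
    then show False using u' by simp
  qed
  show "u < r2"
  proof (rule ccontr)
    assume "\<not> u < r2"
    then have "(u - r1) * (u - r2) * (u - r3) \<le> 0" using ord u3
      by (intro mult_nonneg_nonpos mult_nonneg_nonneg) auto
    then show False using u' by simp
  qed
  show "r2 < v"
  proof (rule ccontr)
    assume "\<not> r2 < v"
    then have "(v - r1) * (v - r2) * (v - r3) \<ge> 0" using ord v1
      by (intro mult_nonpos_nonpos mult_nonneg_nonpos) auto
    then show False using v' by simp
  qed
qed

text \<open>
  For \<open>C = a - i b\<close> the three linear factors belong to twice the real parts of \<open>C\<close> and of its products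
  with the two primitive cube roots of unity.
\<close>

lemma three_times_angle_roots:
  fixes X a b :: real
  shows "(X - (- a - sqrt 3 * b)) * (X - 2 * a) * (X - (- a + sqrt 3 * b))
    = X ^ 3 - 3 * (a\<^sup>2 + b\<^sup>2) * X - 2 * (a ^ 3 - 3 * a * b\<^sup>2)"
proof -
  have "(X - (- a - sqrt 3 * b)) * (X - (- a + sqrt 3 * b)) = (X + a)\<^sup>2 - (sqrt 3 * b)\<^sup>2"
    by algebra
  then have "(X - (- a - sqrt 3 * b)) * (X - (- a + sqrt 3 * b)) = (X + a)\<^sup>2 - 3 * b\<^sup>2"
    by (simp add: power_mult_distrib)
  then show ?thesis by algebra
qed

text \<open>
  The principal cube root of a number in the upper half plane has argument in \<open>(0, \<pi>/3)\<close>, and the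
  factor \<open>- (1 + i \<surd>3)\<close> rotates it by \<open>- 2\<pi>/3\<close>. So the argument of \<open>C\<close> lies in \<open>(- 2\<pi>/3, - \<pi>/3)\<close>,
  which makes \<open>2 Re C\<close> the middle one of the three roots of the depressed cubic.
\<close>

lemma Cardano_complex:
  fixes z :: complex
  assumes z: "Im z > 0"
  defines "C \<equiv> - (1 + \<i> * complex_of_real (sqrt 3)) * z powr (1 / 3)"
  shows "C ^ 3 = 8 * z" "- Re C - sqrt 3 * - Im C \<le> 2 * Re C" "2 * Re C \<le> - Re C + sqrt 3 * - Im C"
proof -
  define W where "W = z powr (1 / 3)"
  have z0: "z \<noteq> 0" using z by auto
  have W_exp: "W = exp (Ln z / 3)" using z0 by (simp add: W_def powr_def)
  have "W ^ 3 = exp (Ln z)" unfolding W_exp by (simp flip: exp_of_nat_mult)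
  then have W3: "W ^ 3 = z" using z0 by simp
  have w2: "(complex_of_real (sqrt 3))\<^sup>2 = 3"
    by (metis of_real_numeral of_real_power real_sqrt_pow2 zero_le_numeral)
  have "(- (1 + \<i> * complex_of_real (sqrt 3))) ^ 3 = 8"
  proof -
    have "(\<i> * complex_of_real (sqrt 3))\<^sup>2 = -3" by (simp add: power_mult_distrib w2)
    then show ?thesis by algebra
  qed
  then show "C ^ 3 = 8 * z" unfolding C_def W_def[symmetric] power_mult_distrib W3 by simp
  define r where "r = exp (ln (cmod z) / 3)"
  define \<theta> where "\<theta> = Im (Ln z) / 3"
  have \<theta>: "0 < \<theta>" "\<theta> < pi / 3"
    using Im_Ln_pos_lt_imp[OF z] by (simp_all add: \<theta>_def)
  have W: "Re W = r * cos \<theta>" "Im W = r * sin \<theta>"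
    unfolding W_exp using z0 by (simp_all add: Re_exp Im_exp r_def \<theta>_def)
  have C: "Re C = sqrt 3 * Im W - Re W" "Im C = - (sqrt 3 * Re W) - Im W"
    unfolding C_def W_def[symmetric] by simp_all
  have w: "sqrt 3 * (sqrt 3 * x) = 3 * x" for x :: real
    by (simp flip: mult.assoc)
  have r: "r > 0" by (simp add: r_def)
  have q: "Im W \<ge> 0" unfolding W using r \<theta> by (intro mult_nonneg_nonneg sin_ge_zero) auto
  have "sin (pi / 3 - \<theta>) \<ge> 0" using \<theta> by (intro sin_ge_zero) auto
  then have "sqrt 3 * cos \<theta> - sin \<theta> \<ge> 0" by (simp add: sin_diff sin_60 cos_60)
  then have "r * (sqrt 3 * cos \<theta> - sin \<theta>) \<ge> 0" using r by simp
  then have q': "Im W \<le> sqrt 3 * Re W" unfolding W by (simp add: algebra_simps)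
  have "sqrt 3 * Im W \<le> 3 * Re W"
    using mult_left_mono[OF q', of "sqrt 3"] by (simp add: w)
  then show "- Re C - sqrt 3 * - Im C \<le> 2 * Re C" "2 * Re C \<le> - Re C + sqrt 3 * - Im C"
    unfolding C using q by (simp_all add: w algebra_simps)
qed

section \<open>Legendre transform and the explicit rate function\<close>

text \<open>
  The stationarity condition for \<open>s \<mapsto> s c + half_mean_log \<phi> s\<close> can be brought to the form
  \<open>\<surd>p \<surd>q (1 + 2 s c) = 1\<close> with \<open>p = 1 - 2 s (1 + \<phi>)\<^sup>2\<close> and \<open>q = 1 - 2 s (1 - \<phi>)\<^sup>2\<close>. Its square is a
  quartic equation with the spurious root \<open>s = 0\<close>; the cubic is what remains after that root is removed.
\<close>

definition critical_cubic :: "real \<Rightarrow> real \<Rightarrow> real \<Rightarrow> real" where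
  "critical_cubic \<phi> c s = 8 * (\<phi>\<^sup>2 - 1)\<^sup>2 * c\<^sup>2 * s ^ 3
     + 4 * (2 * c * (\<phi>\<^sup>2 - 1)\<^sup>2 - 2 * (1 + \<phi>\<^sup>2) * c\<^sup>2) * s\<^sup>2
     + 2 * ((\<phi>\<^sup>2 - 1)\<^sup>2 + c\<^sup>2 - 4 * c * (1 + \<phi>\<^sup>2)) * s + (2 * c - 2 * (1 + \<phi>\<^sup>2))"

lemma critical_cubic_quartic:
  "(1 - 2 * s * (1 + \<phi>)\<^sup>2) * (1 - 2 * s * (1 - \<phi>)\<^sup>2) * (1 + 2 * s * c)\<^sup>2 = 1 + 2 * s * critical_cubic \<phi> c s"
  unfolding critical_cubic_def by algebra

text \<open>
  The shift by \<open>A_fun\<close> removes the quadratic term of the cubic. The last coefficient is \<open>- 16\<close> times the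
  real part of the number under the cube root in \<open>C_fun\<close>.
\<close>

lemma critical_cubic_depressed:
  fixes \<phi> c s :: real
  defines "T \<equiv> 12 * c\<^sup>2 * (\<phi>\<^sup>2 - 1)\<^sup>2 * s - A_fun \<phi> c"
  shows "216 * c ^ 4 * (\<phi>\<^sup>2 - 1) ^ 4 * critical_cubic \<phi> c s
    = T ^ 3 - 3 * B_fun \<phi> c * T - 16 * (- (c^6) * (\<phi>^6 - 33 * \<phi>^4 - 33 * \<phi>^2 + 1)
         - 6 * c^5 * (\<phi>^2 - 1)^2 * (\<phi>^4 - 10 * \<phi>^2 + 1)
         + 6 * c^4 * (\<phi>^2 - 1)^4 * (\<phi>^2 + 1)
         + c^3 * (\<phi>^2 - 1)^6)"
proof -
  define q where "q = \<phi>\<^sup>2"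
  have q: "\<phi>^4 = q^2" "\<phi>^6 = q^3" by (simp_all add: q_def flip: power_mult)
  have "12 * c\<^sup>2 * (q - 1)\<^sup>2 * s = 4 * c * (c * (q + 1) - (q - 1)\<^sup>2) + T"
    by (simp add: T_def A_fun_def q_def)
  then show ?thesis
    unfolding B_fun_def critical_cubic_def q q_def[symmetric] by algebra
qed

text \<open>
  The cubic has the value \<open>c > 0\<close> at \<open>- 1 / (2 c)\<close> and a negative value at the zeros
  of \<open>1 - 2 s (1 \<plusminus> \<phi>)\<^sup>2\<close>, since there the product in \<open>critical_cubic_quartic\<close> vanishes.
  So its middle root, which is the one
  that Cardano's formula with these branches selects, lies in the domain and satisfies \<open>1 + 2 l c > 0\<close>;
  each of the other two roots fails one of these conditions.
\<close>

lemma lambda_fun_critical: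
  assumes phi: "\<phi> \<in> {-1<..<1}" and c: "c > 0"
  defines "l \<equiv> lambda_fun \<phi> c"
  shows "critical_cubic \<phi> c l = 0" "1 + 2 * l * c > 0" "1 - 2 * l * (1 + \<phi>)\<^sup>2 > 0" "1 - 2 * l * (1 - \<phi>)\<^sup>2 > 0"
proof -
  define R where "R = - (c^6) * (\<phi>^6 - 33 * \<phi>^4 - 33 * \<phi>^2 + 1)
         - 6 * c^5 * (\<phi>^2 - 1)^2 * (\<phi>^4 - 10 * \<phi>^2 + 1)
         + 6 * c^4 * (\<phi>^2 - 1)^4 * (\<phi>^2 + 1)
         + c^3 * (\<phi>^2 - 1)^6"
  define cc where "cc = c_fun \<phi> c"
  define z where "z = complex_of_real R + 3 * complex_of_real (sqrt 3) * csqrt (complex_of_real cc)"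
  define C where "C = C_fun \<phi> c"
  define B where "B = B_fun \<phi> c"
  have C_eq: "C = - (1 + \<i> * complex_of_real (sqrt 3)) * z powr (1/3)"
    unfolding C_def C_fun_def z_def R_def cc_def ..
  have "\<phi>^2 < 1" using phi by (simp add: abs_square_less_1 abs_less_iff)
  then have e0: "\<phi>^2 - 1 \<noteq> 0" by simp
  have "0 < (4 * c^4 * \<phi>^2 + 32 * c^3 * (\<phi>^4 + \<phi>^2)
       + c^2 * (\<phi>^4 + 46 * \<phi>^2 + 1) * (\<phi>^2 - 1)^2
       + 6 * c * (\<phi>^2 + 1) * (\<phi>^2 - 1)^4 + (\<phi>^2 - 1)^6)"
    using c e0 by (intro add_nonneg_pos add_nonneg_nonneg mult_nonneg_nonneg) auto
  then have c_neg: "cc < 0"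
    unfolding cc_def c_fun_def using c e0 by (simp add: mult_neg_pos)
  have "csqrt (complex_of_real cc) = \<i> * complex_of_real (sqrt (- cc))"
    using c_neg by (simp add: csqrt_of_real_nonpos)
  then have z: "z = Complex R (3 * sqrt 3 * sqrt (- cc))"
    by (simp add: z_def complex_eq_iff)
  have "Im z > 0" using c_neg by (simp add: z)
  note Cardano = Cardano_complex[OF this, folded C_eq]
  have B_pos: "B > 0"
    unfolding B_def B_fun_def using c e0
    by (intro mult_pos_pos add_nonneg_pos add_nonneg_nonneg mult_nonneg_nonneg) auto
  have zR: "(cmod z)\<^sup>2 = R\<^sup>2 - 27 * cc"
    using c_neg by (simp add: z cmod_power2 power_mult_distrib)
  have "64 * (R\<^sup>2 - 27 * cc) = B ^ 3"
  proof -
    define q where "q = \<phi>\<^sup>2"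
    have q: "\<phi>^4 = q^2" "\<phi>^6 = q^3" by (simp_all add: q_def flip: power_mult)
    show ?thesis unfolding R_def cc_def c_fun_def B_def B_fun_def q q_def[symmetric] by algebra
  qed
  then have "((cmod C)\<^sup>2) ^ 3 = B ^ 3"
  proof -
    have "((cmod C)\<^sup>2) ^ 3 = (cmod (C ^ 3))\<^sup>2" by (simp add: norm_power flip: power_mult)
    also have "\<dots> = 64 * (cmod z)\<^sup>2" by (simp add: Cardano(1) norm_mult power_mult_distrib)
    finally show ?thesis using \<open>64 * (R\<^sup>2 - 27 * cc) = B ^ 3\<close> zR by simp
  qed
  then have CB: "(cmod C)\<^sup>2 = B"
    using B_pos by (metis less_imp_le power_eq_imp_eq_base zero_le_power2 zero_less_numeral)
  have C0: "C \<noteq> 0" using CB B_pos by auto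
  define a where "a = Re C"
  define b where "b = - Im C"
  have B_ab: "a\<^sup>2 + b\<^sup>2 = B" using CB by (simp add: a_def b_def cmod_power2)
  have R_ab: "a ^ 3 - 3 * a * b\<^sup>2 = 8 * R"
  proof -
    have "8 * R = Re (C ^ 3)" by (simp add: Cardano(1) z)
    also have "\<dots> = a ^ 3 - 3 * a * b\<^sup>2"
      by (simp add: a_def b_def power3_eq_cube power2_eq_square algebra_simps)
    finally show ?thesis by simp
  qed
  define D where "D = 12 * c\<^sup>2 * (\<phi>\<^sup>2 - 1)\<^sup>2"
  have D: "D > 0" using c e0 by (simp add: D_def)
  define A where "A = A_fun \<phi> c"
  have l: "D * l - A = 2 * a"
  proof -
    have "complex_of_real B / C = cnj C"
      using C0 complex_norm_square[of C] by (simp add: CB[symmetric] field_simps)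
    then have "lambda_complex \<phi> c = (complex_of_real A + (C + cnj C)) / complex_of_real D"
      unfolding lambda_complex_def B_def C_def A_def D_def by (simp add: add_ac)
    also have "\<dots> = complex_of_real ((A + 2 * a) / D)"
      by (simp add: complex_add_cnj a_def)
    finally have "l = (A + 2 * a) / D" by (simp add: l_def lambda_fun_def)
    then show ?thesis using D by simp
  qed
  have fact: "((D * s - A) - (- a - sqrt 3 * b)) * ((D * s - A) - 2 * a) * ((D * s - A) - (- a + sqrt 3 * b))
     = 216 * c ^ 4 * (\<phi>\<^sup>2 - 1) ^ 4 * critical_cubic \<phi> c s" for s
    unfolding three_times_angle_roots B_ab R_ab critical_cubic_depressed R_def[symmetric]
    by (simp add: D_def A_def B_def)
  have pre: "216 * c ^ 4 * (\<phi>\<^sup>2 - 1) ^ 4 > 0" using c e0 by simp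
  show "critical_cubic \<phi> c l = 0" using fact[of l] c e0 l by simp
  have ord: "- a - sqrt 3 * b \<le> 2 * a" "2 * a \<le> - a + sqrt 3 * b"
    using Cardano(2,3) by (simp_all add: a_def b_def)
  have "critical_cubic \<phi> c (- 1 / (2 * c)) = c"
    using c by (simp add: critical_cubic_def power2_eq_square power3_eq_cube field_simps)
  then have u: "1 * (((D * (- 1 / (2 * c)) - A) - (- a - sqrt 3 * b)) * ((D * (- 1 / (2 * c)) - A) - 2 * a) * ((D * (- 1 / (2 * c)) - A) - (- a + sqrt 3 * b))) > 0"
    unfolding fact using c pre by simp
  have between: "- 1 / (2 * c) < l" "l < 1 / (2 * m)" if m: "m > 0" "m = (1 + \<phi>)\<^sup>2 \<or> m = (1 - \<phi>)\<^sup>2" for m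
  proof -
    have "1 + 2 * (1 / (2 * m)) * critical_cubic \<phi> c (1 / (2 * m)) = 0"
      unfolding critical_cubic_quartic[symmetric] using m by auto
    then have "critical_cubic \<phi> c (1 / (2 * m)) = - m" using m(1) by (simp add: field_simps)
    then have v: "1 * (((D * (1 / (2 * m)) - A) - (- a - sqrt 3 * b)) * ((D * (1 / (2 * m)) - A) - 2 * a) * ((D * (1 / (2 * m)) - A) - (- a + sqrt 3 * b))) < 0"
      unfolding fact mult_1 using m pre by (simp add: mult_pos_neg)
    have "- 1 / (2 * c) < 1 / (2 * m)" using c m(1) by (smt (verit) divide_neg_pos divide_pos_pos)
    then have uv: "D * (- 1 / (2 * c)) - A < D * (1 / (2 * m)) - A"
      using D by (simp only: diff_strict_right_mono mult_strict_left_mono)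
    have "D * (- 1 / (2 * c)) - A < D * l - A" "D * l - A < D * (1 / (2 * m)) - A"
      unfolding l using cubic_middle_root[OF _ ord uv u v] by auto
    then show "- 1 / (2 * c) < l" "l < 1 / (2 * m)" using D by (simp_all only: diff_less_mono2 mult_less_cancel_left_pos diff_less_eq add_diff_cancel_right' diff_add_cancel less_diff_eq)
  qed
  have al: "(1 + \<phi>)\<^sup>2 > 0" "(1 - \<phi>)\<^sup>2 > 0" using phi by auto
  show "1 + 2 * l * c > 0" using between(1)[OF al(1)] c by (simp add: field_simps)
  show "1 - 2 * l * (1 + \<phi>)\<^sup>2 > 0" using between(2)[OF al(1)] al(1) by (simp add: less_divide_eq mult.commute mult.left_commute)
  show "1 - 2 * l * (1 - \<phi>)\<^sup>2 > 0" using between(2)[OF al(2)] al(2) by (simp add: less_divide_eq mult.commute mult.left_commute)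
qed

text \<open>
  Squaring lost a sign, which \<open>1 + 2 l c > 0\<close> restores. When \<open>l = 0\<close> the quartic carries no
  information, and the cubic itself gives \<open>c = 1 + \<phi>\<^sup>2\<close>, the variance of the process.
\<close>

lemma lambda_fun_stationary:
  assumes phi: "\<phi> \<in> {-1<..<1}" and c: "c > 0"
  defines "l \<equiv> lambda_fun \<phi> c"
  defines "u \<equiv> sqrt (1 - 2 * l * (1 + \<phi>)\<^sup>2)" and "v \<equiv> sqrt (1 - 2 * l * (1 - \<phi>)\<^sup>2)"
  shows "((1 + \<phi>)\<^sup>2 / u + (1 - \<phi>)\<^sup>2 / v) / (u + v) = c"
proof -
  note crit = lambda_fun_critical[OF phi c, folded l_def]
  have uv: "u > 0" "v > 0" using crit by (auto simp: u_def v_def)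
  have sq: "u\<^sup>2 = 1 - 2 * l * (1 + \<phi>)\<^sup>2" "v\<^sup>2 = 1 - 2 * l * (1 - \<phi>)\<^sup>2" using crit by (auto simp: u_def v_def)
  have eq: "c * (u + v) * (u * v) = (1 + \<phi>)\<^sup>2 * v + (1 - \<phi>)\<^sup>2 * u"
  proof (cases "l = 0")
    case True
    then have "2 * c = (1 + \<phi>)\<^sup>2 + (1 - \<phi>)\<^sup>2"
      using crit(1) by (simp add: critical_cubic_def power2_eq_square algebra_simps)
    moreover have "u = 1" "v = 1" using True by (auto simp: u_def v_def)
    ultimately show ?thesis by simp
  next
    case False
    have "(u * v * (1 + 2 * l * c))\<^sup>2 = 1"
      unfolding power_mult_distrib sq critical_cubic_quartic crit(1) by simp
    moreover have "u * v * (1 + 2 * l * c) > 0" using uv crit(2) by simp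
    ultimately have "u * v * (1 + 2 * l * c) = 1" by (simp add: power2_eq_1_iff)
    then have "2 * l * (c * (u + v) * (u * v) - ((1 + \<phi>)\<^sup>2 * v + (1 - \<phi>)\<^sup>2 * u)) = 0"
      using sq by algebra
    then show ?thesis using False by simp
  qed
  have "u + v > 0" using uv by simp
  then show ?thesis using uv eq by (simp add: divide_eq_eq add_frac_eq mult.commute mult.left_commute mult.assoc)
qed

lemma sqrt_le_tangent:
  fixes x u :: real
  assumes "x \<ge> 0" "u > 0"
  shows "sqrt x \<le> u + (x - u\<^sup>2) / (2 * u)"
proof -
  have "0 \<le> (sqrt x - u)\<^sup>2" by simp
  then show ?thesis using assms by (simp add: power2_diff field_simps power2_eq_square)
qed

text \<open>
  A stationary point of the concave function \<open>s \<mapsto> s c + half_mean_log \<phi> s\<close> is a maximum; the concavity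
  enters through the tangent bounds for the square root and the logarithm at the point \<open>l\<close>.
\<close>

lemma lambda_fun_maximizes:
  assumes phi: "\<phi> \<in> {-1<..<1}" and c: "c > 0"
    and s: "1 - 2 * s * (1 + \<phi>)\<^sup>2 > 0" "1 - 2 * s * (1 - \<phi>)\<^sup>2 > 0"
  shows "s * c + half_mean_log \<phi> s \<le> lambda_fun \<phi> c * c + half_mean_log \<phi> (lambda_fun \<phi> c)"
proof -
  define l where "l = lambda_fun \<phi> c"
  define u where "u = sqrt (1 - 2 * l * (1 + \<phi>)\<^sup>2)"
  define v where "v = sqrt (1 - 2 * l * (1 - \<phi>)\<^sup>2)"
  note crit = lambda_fun_critical[OF phi c, folded l_def]
  have uv: "u > 0" "v > 0" using crit by (auto simp: u_def v_def)
  have sq: "u\<^sup>2 = 1 - 2 * l * (1 + \<phi>)\<^sup>2" "v\<^sup>2 = 1 - 2 * l * (1 - \<phi>)\<^sup>2" using crit by (auto simp: u_def v_def)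
  define p where "p = sqrt (1 - 2 * s * (1 + \<phi>)\<^sup>2)"
  define q where "q = sqrt (1 - 2 * s * (1 - \<phi>)\<^sup>2)"
  have pq: "p > 0" "q > 0" using s by (auto simp: p_def q_def)
  have stat: "((1 + \<phi>)\<^sup>2 / u + (1 - \<phi>)\<^sup>2 / v) / (u + v) = c"
    using lambda_fun_stationary[OF phi c] unfolding l_def u_def v_def .
  have uv0: "u + v > 0" using uv by simp
  have "p \<le> u - (s - l) * ((1 + \<phi>)\<^sup>2 / u)"
    using sqrt_le_tangent[of "1 - 2 * s * (1 + \<phi>)\<^sup>2" u] s uv unfolding p_def sq by (simp add: field_simps)
  moreover have "q \<le> v - (s - l) * ((1 - \<phi>)\<^sup>2 / v)"
    using sqrt_le_tangent[of "1 - 2 * s * (1 - \<phi>)\<^sup>2" v] s uv unfolding q_def sq by (simp add: field_simps)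
  ultimately have "p + q \<le> (u + v) - (s - l) * ((1 + \<phi>)\<^sup>2 / u + (1 - \<phi>)\<^sup>2 / v)"
    by (simp add: algebra_simps)
  also have "(1 + \<phi>)\<^sup>2 / u + (1 - \<phi>)\<^sup>2 / v = c * (u + v)"
    using stat uv0 by (simp add: divide_eq_eq)
  finally have "p + q \<le> (u + v) * (1 - (s - l) * c)" by (simp add: algebra_simps)
  then have le: "(p + q) / (u + v) \<le> 1 - (s - l) * c" using uv0 by (simp add: divide_le_eq mult.commute)
  have "ln ((p + q) / (u + v)) \<le> (p + q) / (u + v) - 1"
    using pq uv by (intro ln_le_minus_one) simp
  with le have "ln ((p + q) / (u + v)) \<le> - ((s - l) * c)" by linarith
  moreover have "ln ((p + q) / (u + v)) = ln ((p + q) / 2) - ln ((u + v) / 2)"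
    using pq uv by (simp add: ln_div)
  ultimately show ?thesis
    unfolding half_mean_log_def l_def[symmetric] p_def[symmetric] q_def[symmetric] u_def[symmetric] v_def[symmetric]
    by (simp add: algebra_simps)
qed

lemma K_fun_eq:
  assumes phi: "\<phi> \<in> {-1<..<1}" and c: "c > 0"
  shows "K_fun \<phi> c = ereal (c * lambda_fun \<phi> c + half_mean_log \<phi> (lambda_fun \<phi> c))"
proof -
  define l where "l = lambda_fun \<phi> c"
  define u where "u = sqrt (1 - 2 * l * (1 + \<phi>)\<^sup>2)"
  define v where "v = sqrt (1 - 2 * l * (1 - \<phi>)\<^sup>2)"
  note crit = lambda_fun_critical[OF phi c, folded l_def]
  have uv: "u > 0" "v > 0" using crit by (auto simp: u_def v_def)
  have sq: "u\<^sup>2 = 1 - 2 * l * (1 + \<phi>)\<^sup>2" "v\<^sup>2 = 1 - 2 * l * (1 - \<phi>)\<^sup>2" using crit by (auto simp: u_def v_def)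
  have "(1 - 2 * l * (1 + \<phi>\<^sup>2))\<^sup>2 - 16 * l\<^sup>2 * \<phi>\<^sup>2 = (u * v)\<^sup>2"
    unfolding power_mult_distrib sq by algebra
  then have "sqrt ((1 - 2 * l * (1 + \<phi>\<^sup>2))\<^sup>2 - 16 * l\<^sup>2 * \<phi>\<^sup>2) = u * v"
    using uv by simp
  moreover have "1 - 2 * l * (1 + \<phi>\<^sup>2) = (u\<^sup>2 + v\<^sup>2) / 2"
    unfolding sq by (simp add: power2_eq_square field_simps)
  ultimately have "(1 - 2 * l * (1 + \<phi>\<^sup>2) + sqrt ((1 - 2 * l * (1 + \<phi>\<^sup>2))\<^sup>2 - 16 * l\<^sup>2 * \<phi>\<^sup>2)) / 2 = ((u + v) / 2)\<^sup>2"
    by (simp add: power2_eq_square field_simps)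
  then show ?thesis
    using c uv unfolding K_fun_def half_mean_log_def l_def[symmetric] u_def[symmetric] v_def[symmetric]
    by (simp add: ln_realpow Let_def)
qed

lemma inner_minus_ma1_log_mgf:
  "(t, s) \<bullet> (x, y) - ma1_log_mgf \<phi> (t, s)
     = t * x - t\<^sup>2 * (1 + \<phi>)\<^sup>2 / (2 * (1 - 2 * s * (1 + \<phi>)\<^sup>2)) + s * y + half_mean_log \<phi> s"
  by (simp add: ma1_log_mgf_def inner_prod_def)

text \<open>
  For fixed \<open>s\<close> the supremum over \<open>t\<close> is that of a quadratic polynomial; the next lemma shows that the
  \<open>t\<close> taken here attains it.
\<close>

lemma inner_minus_ma1_log_mgf_optimal:
  assumes "(1 + \<phi>)\<^sup>2 > 0" and p: "1 - 2 * s * (1 + \<phi>)\<^sup>2 > 0"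
  shows "(x * (1 - 2 * s * (1 + \<phi>)\<^sup>2) / (1 + \<phi>)\<^sup>2, s) \<bullet> (x, y) - ma1_log_mgf \<phi> (x * (1 - 2 * s * (1 + \<phi>)\<^sup>2) / (1 + \<phi>)\<^sup>2, s)
     = s * (y - x\<^sup>2) + half_mean_log \<phi> s + x\<^sup>2 / (2 * (1 + \<phi>)\<^sup>2)"
proof -
  define \<alpha> where "\<alpha> = (1 + \<phi>)\<^sup>2"
  define p where "p = 1 - 2 * s * \<alpha>"
  have "\<alpha> > 0" "p > 0" using assms by (auto simp: \<alpha>_def p_def)
  then have "x * p / \<alpha> * x - (x * p / \<alpha>)\<^sup>2 * \<alpha> / (2 * p) = x\<^sup>2 * p / (2 * \<alpha>)"
    by (simp add: power2_eq_square field_simps)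
  also have "\<dots> = x\<^sup>2 / (2 * \<alpha>) - s * x\<^sup>2" using \<open>\<alpha> > 0\<close> by (simp add: p_def field_simps)
  finally show ?thesis unfolding inner_minus_ma1_log_mgf \<alpha>_def[symmetric] p_def[symmetric]
    by (simp add: algebra_simps)
qed

lemma inner_minus_ma1_log_mgf_le:
  assumes "(1 + \<phi>)\<^sup>2 > 0" and p: "1 - 2 * s * (1 + \<phi>)\<^sup>2 > 0"
  shows "(t, s) \<bullet> (x, y) - ma1_log_mgf \<phi> (t, s) \<le> s * (y - x\<^sup>2) + half_mean_log \<phi> s + x\<^sup>2 / (2 * (1 + \<phi>)\<^sup>2)"
proof -
  define \<alpha> where "\<alpha> = (1 + \<phi>)\<^sup>2"
  define p where "p = 1 - 2 * s * \<alpha>"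
  have pos: "\<alpha> > 0" "p > 0" using assms by (auto simp: \<alpha>_def p_def)
  have "0 \<le> (t * \<alpha> - x * p)\<^sup>2 / (2 * p * \<alpha>)" using pos by simp
  also have "\<dots> = t\<^sup>2 * \<alpha> / (2 * p) + x\<^sup>2 * p / (2 * \<alpha>) - t * x"
    using pos by (simp add: power2_eq_square field_simps)
  also have "x\<^sup>2 * p / (2 * \<alpha>) = x\<^sup>2 / (2 * \<alpha>) - s * x\<^sup>2" using pos by (simp add: p_def field_simps)
  finally show ?thesis unfolding inner_minus_ma1_log_mgf \<alpha>_def[symmetric] p_def[symmetric]
    by (simp add: algebra_simps)
qed

text \<open>
  For \<open>y \<le> x\<^sup>2\<close> nothing bounds the supremum as \<open>s\<close> tends to \<open>- \<infinity>\<close>: the term \<open>s (y - x\<^sup>2)\<close> is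
  nonnegative and \<open>half_mean_log \<phi> s\<close> tends to \<open>\<infinity>\<close>.
\<close>

lemma K_S_eq_Legendre_transform:
  assumes phi: "\<phi> \<in> {-1<..<1}"
  shows "K_S \<phi> z = (SUP \<theta>\<in>ma1_domain \<phi>. ereal (\<theta> \<bullet> z - ma1_log_mgf \<phi> \<theta>))"
proof -
  obtain x y where z: "z = (x, y)" by fastforce
  have al: "(1 + \<phi>)\<^sup>2 > 0" "(1 - \<phi>)\<^sup>2 > 0" using phi by auto
  show ?thesis
  proof (cases "y > x\<^sup>2")
    case True
    define c where "c = y - x\<^sup>2"
    have c: "c > 0" using True by (simp add: c_def)
    define l where "l = lambda_fun \<phi> c"
    note crit = lambda_fun_critical[OF phi c, folded l_def]
    have K: "K_S \<phi> z = ereal (l * c + half_mean_log \<phi> l + x\<^sup>2 / (2 * (1 + \<phi>)\<^sup>2))"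
      using True K_fun_eq[OF phi c] by (simp add: K_S_def z c_def l_def mult.commute)
    show ?thesis unfolding K
    proof (rule antisym[OF _ SUP_least])
      have "ereal (l * c + half_mean_log \<phi> l + x\<^sup>2 / (2 * (1 + \<phi>)\<^sup>2)) = ereal
        ((x * (1 - 2 * l * (1 + \<phi>)\<^sup>2) / (1 + \<phi>)\<^sup>2, l) \<bullet> z - ma1_log_mgf \<phi> (x * (1 - 2 * l * (1 + \<phi>)\<^sup>2) / (1 + \<phi>)\<^sup>2, l))"
        unfolding z inner_minus_ma1_log_mgf_optimal[OF al(1) crit(3)] c_def ..
      also have "\<dots> \<le> (SUP \<theta>\<in>ma1_domain \<phi>. ereal (\<theta> \<bullet> z - ma1_log_mgf \<phi> \<theta>))"
        using crit by (intro SUP_upper) (simp add: ma1_domain_def)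
      finally show "ereal (l * c + half_mean_log \<phi> l + x\<^sup>2 / (2 * (1 + \<phi>)\<^sup>2)) \<le> \<dots>" .
    next
      fix \<theta> assume "\<theta> \<in> ma1_domain \<phi>"
      then obtain t s where ts: "\<theta> = (t, s)" "1 - 2 * s * (1 + \<phi>)\<^sup>2 > 0" "1 - 2 * s * (1 - \<phi>)\<^sup>2 > 0"
        by (auto simp: ma1_domain_def)
      show "ereal (\<theta> \<bullet> z - ma1_log_mgf \<phi> \<theta>) \<le> ereal (l * c + half_mean_log \<phi> l + x\<^sup>2 / (2 * (1 + \<phi>)\<^sup>2))"
        using inner_minus_ma1_log_mgf_le[OF al(1) ts(2), of t x y] lambda_fun_maximizes[OF phi c ts(2,3)]
        unfolding z ts(1) c_def[symmetric] l_def[symmetric] by simp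
    qed
  next
    case False
    have "(SUP \<theta>\<in>ma1_domain \<phi>. ereal (\<theta> \<bullet> z - ma1_log_mgf \<phi> \<theta>)) = \<infinity>"
    proof (rule SUP_PInfty)
      fix n :: nat
      \<comment> \<open>This \<open>s\<close> makes the first square root in \<open>half_mean_log\<close> at least \<open>2 exp n\<close>.\<close>
      define s where "s = - ((2 * exp (real n))\<^sup>2 / (2 * (1 + \<phi>)\<^sup>2))"
      have s: "s \<le> 0" using al by (simp add: s_def)
      have p: "1 - 2 * s * (1 + \<phi>)\<^sup>2 = 1 + (2 * exp (real n))\<^sup>2" using al by (simp add: s_def)
      have p0: "1 - 2 * s * (1 + \<phi>)\<^sup>2 > 0" unfolding p by (intro add_pos_nonneg) auto
      have q: "1 - 2 * s * (1 - \<phi>)\<^sup>2 > 0" using s by (smt (verit) mult_nonneg_nonneg zero_le_power2 mult_minus_left)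
      have mean: "e \<le> (a + b) / 2" if "2 * e \<le> a" "0 \<le> b" for e a b :: real
        using that by simp
      have "2 * exp (real n) \<le> sqrt (1 - 2 * s * (1 + \<phi>)\<^sup>2)" unfolding p by (rule real_le_rsqrt) simp
      then have "exp (real n) \<le> (sqrt (1 - 2 * s * (1 + \<phi>)\<^sup>2) + sqrt (1 - 2 * s * (1 - \<phi>)\<^sup>2)) / 2"
        using real_sqrt_ge_zero[OF less_imp_le[OF q]] mean by blast
      then have 1: "real n \<le> half_mean_log \<phi> s"
        unfolding half_mean_log_def using exp_gt_zero[of "real n"] by (subst ln_ge_iff) linarith+
      have 2: "s * (y - x\<^sup>2) \<ge> 0" using s False by (intro mult_nonpos_nonpos) auto
      have 3: "0 \<le> x\<^sup>2 / (2 * (1 + \<phi>)\<^sup>2)" by simp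
      show "\<exists>\<theta>\<in>ma1_domain \<phi>. ereal (real n) \<le> ereal (\<theta> \<bullet> z - ma1_log_mgf \<phi> \<theta>)"
      proof (rule bexI)
        show "ereal (real n) \<le> ereal ((x * (1 - 2 * s * (1 + \<phi>)\<^sup>2) / (1 + \<phi>)\<^sup>2, s) \<bullet> z - ma1_log_mgf \<phi> (x * (1 - 2 * s * (1 + \<phi>)\<^sup>2) / (1 + \<phi>)\<^sup>2, s))"
          unfolding z inner_minus_ma1_log_mgf_optimal[OF al(1) p0] using add_mono[OF add_mono[OF 2 1] 3] by simp
        show "(x * (1 - 2 * s * (1 + \<phi>)\<^sup>2) / (1 + \<phi>)\<^sup>2, s) \<in> ma1_domain \<phi>"
          using p0 q by (simp add: ma1_domain_def)
      qed
    qed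
    then show ?thesis using False by (simp add: K_S_def z)
  qed
qed

lemma open_ma1_domain: "open (ma1_domain \<phi>)"
proof -
  have "open {z :: real \<times> real. 0 < 1 - 2 * snd z * (1 + \<phi>)\<^sup>2}" "open {z :: real \<times> real. 0 < 1 - 2 * snd z * (1 - \<phi>)\<^sup>2}"
    by (intro open_Collect_less continuous_intros)+
  then show ?thesis unfolding ma1_domain_def case_prod_beta by (rule open_Collect_conj)
qed

lemma ma1_log_mgf_has_derivative:
  fixes t s \<phi> :: real
  defines "u \<equiv> sqrt (1 - 2 * s * (1 + \<phi>)\<^sup>2)" and "v \<equiv> sqrt (1 - 2 * s * (1 - \<phi>)\<^sup>2)"
  assumes dom: "(t, s) \<in> ma1_domain \<phi>"
  shows "(ma1_log_mgf \<phi> has_derivative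
     (\<lambda>h. (t * (1 + \<phi>)\<^sup>2 / u\<^sup>2, (t * (1 + \<phi>)\<^sup>2 / u\<^sup>2)\<^sup>2 + ((1 + \<phi>)\<^sup>2 / u + (1 - \<phi>)\<^sup>2 / v) / (u + v)) \<bullet> h)) (at (t, s))"
proof -
  define \<alpha> where "\<alpha> = (1 + \<phi>)\<^sup>2"
  define \<beta> where "\<beta> = (1 - \<phi>)\<^sup>2"
  have p: "1 - 2 * s * \<alpha> > 0" "1 - 2 * s * \<beta> > 0" using dom by (auto simp: ma1_domain_def \<alpha>_def \<beta>_def)
  have u2: "u\<^sup>2 = 1 - 2 * s * \<alpha>" using p by (simp add: u_def \<alpha>_def)
  have uv: "u > 0" "v > 0" using p by (auto simp: u_def v_def \<alpha>_def \<beta>_def)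
  define F where "F = (\<lambda>s. \<alpha> / (2 * (1 - 2 * s * \<alpha>)))"
  define G where "G = (\<lambda>s. ln ((sqrt (1 - 2 * s * \<alpha>) + sqrt (1 - 2 * s * \<beta>)) / 2))"
  have F: "(F has_real_derivative (\<alpha> / u\<^sup>2)\<^sup>2) (at s)"
  proof -
    have "((\<lambda>s. 1 - 2 * s * \<alpha>) has_real_derivative - (2 * \<alpha>)) (at s)"
      by (auto intro!: derivative_eq_intros)
    then have "((\<lambda>s. inverse (1 - 2 * s * \<alpha>)) has_real_derivative
        - (inverse (1 - 2 * s * \<alpha>) * - (2 * \<alpha>) * inverse (1 - 2 * s * \<alpha>))) (at s)"
      using p by (intro DERIV_inverse') auto
    from DERIV_cmult[OF this, of "\<alpha> / 2"]
    have "((\<lambda>s. \<alpha> / 2 * inverse (1 - 2 * s * \<alpha>)) has_real_derivative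
        \<alpha> / 2 * - (inverse (1 - 2 * s * \<alpha>) * - (2 * \<alpha>) * inverse (1 - 2 * s * \<alpha>))) (at s)" .
    moreover have "\<alpha> / 2 * - (inverse w * - (2 * \<alpha>) * inverse w) = (\<alpha> / w)\<^sup>2" for w
      by (cases "w = 0") (simp_all add: power2_eq_square field_simps)
    moreover have "(\<lambda>s. \<alpha> / 2 * inverse (1 - 2 * s * \<alpha>)) = F"
      unfolding F_def by (rule ext) (simp only: divide_inverse inverse_mult_distrib mult.assoc)
    ultimately show ?thesis unfolding u2 by simp
  qed
  have G: "(G has_real_derivative - ((\<alpha> / u + \<beta> / v) / (u + v))) (at s)"
  proof -
    have su: "((\<lambda>s. sqrt (1 - 2 * s * \<alpha>)) has_real_derivative - (\<alpha> / u)) (at s)"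
      using p by (auto intro!: derivative_eq_intros simp: u_def \<alpha>_def divide_simps)
    have sv: "((\<lambda>s. sqrt (1 - 2 * s * \<beta>)) has_real_derivative - (\<beta> / v)) (at s)"
      using p by (auto intro!: derivative_eq_intros simp: v_def \<beta>_def divide_simps)
    have g: "((\<lambda>s. (sqrt (1 - 2 * s * \<alpha>) + sqrt (1 - 2 * s * \<beta>)) / 2) has_real_derivative (- (\<alpha> / u) + - (\<beta> / v)) / 2) (at s)"
      by (intro DERIV_cdivide DERIV_add su sv)
    have val: "(sqrt (1 - 2 * s * \<alpha>) + sqrt (1 - 2 * s * \<beta>)) / 2 = (u + v) / 2"
      by (simp add: u_def v_def \<alpha>_def \<beta>_def)
    have "(ln has_real_derivative 1 / ((u + v) / 2)) (at ((sqrt (1 - 2 * s * \<alpha>) + sqrt (1 - 2 * s * \<beta>)) / 2))"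
      unfolding val using uv by (intro DERIV_ln_divide) simp
    from DERIV_chain2[OF this g]
    have "(G has_real_derivative 1 / ((u + v) / 2) * ((- (\<alpha> / u) + - (\<beta> / v)) / 2)) (at s)"
      unfolding G_def .
    moreover have "1 / ((u + v) / 2) * ((- (\<alpha> / u) + - (\<beta> / v)) / 2) = - ((\<alpha> / u + \<beta> / v) / (u + v))"
      by (simp add: divide_simps) (simp add: algebra_simps)
    ultimately show ?thesis by simp
  qed
  have Fz: "((\<lambda>z. F (snd z)) has_derivative (\<lambda>h. (\<alpha> / u\<^sup>2)\<^sup>2 * snd h)) (at (t, s))"
    using has_derivative_compose[OF has_derivative_snd[OF has_derivative_ident], of F "(*) ((\<alpha> / u\<^sup>2)\<^sup>2)" "(t, s)" UNIV] F
    by (simp add: has_field_derivative_def)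
  have Gz: "((\<lambda>z. G (snd z)) has_derivative (\<lambda>h. - ((\<alpha> / u + \<beta> / v) / (u + v)) * snd h)) (at (t, s))"
    using has_derivative_compose[OF has_derivative_snd[OF has_derivative_ident], of G "(*) (- ((\<alpha> / u + \<beta> / v) / (u + v)))" "(t, s)" UNIV] G
    by (simp add: has_field_derivative_def)
  have eq: "ma1_log_mgf \<phi> = (\<lambda>z. (fst z)\<^sup>2 * F (snd z) - G (snd z))"
    by (auto simp: ma1_log_mgf_def half_mean_log_def F_def G_def \<alpha>_def \<beta>_def fun_eq_iff)
  have Fs: "F s = \<alpha> / (2 * u\<^sup>2)" by (simp add: F_def u2)
  have D1: "((\<lambda>z. (fst z)\<^sup>2) has_derivative (\<lambda>h. 2 * t * fst h)) (at (t, s))"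
    by (auto intro!: derivative_eq_intros)
  have "((\<lambda>z. (fst z)\<^sup>2 * F (snd z) - G (snd z)) has_derivative
     (\<lambda>h. (t\<^sup>2 * ((\<alpha> / u\<^sup>2)\<^sup>2 * snd h) + 2 * t * fst h * F s) - - ((\<alpha> / u + \<beta> / v) / (u + v)) * snd h)) (at (t, s))"
    using has_derivative_diff[OF has_derivative_mult[OF D1 Fz] Gz] by simp
  then show ?thesis
    unfolding eq
  proof (rule has_derivative_eq_rhs)
    have scale: "t * \<alpha> / u\<^sup>2 = t * (\<alpha> / u\<^sup>2)" "\<alpha> / (2 * u\<^sup>2) = (\<alpha> / u\<^sup>2) / 2"
      by simp_all
    have gen: "(t\<^sup>2 * (k\<^sup>2 * b) + 2 * t * a * (k / 2)) - - r * b = t * k * a + ((t * k)\<^sup>2 + r) * b"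
      for a b k r by algebra
    show "(\<lambda>h. (t\<^sup>2 * ((\<alpha> / u\<^sup>2)\<^sup>2 * snd h) + 2 * t * fst h * F s) - - ((\<alpha> / u + \<beta> / v) / (u + v)) * snd h)
      = (\<lambda>h. (t * (1 + \<phi>)\<^sup>2 / u\<^sup>2, (t * (1 + \<phi>)\<^sup>2 / u\<^sup>2)\<^sup>2 + ((1 + \<phi>)\<^sup>2 / u + (1 - \<phi>)\<^sup>2 / v) / (u + v)) \<bullet> h)"
      unfolding Fs \<alpha>_def[symmetric] \<beta>_def[symmetric] scale
      by (rule ext) (simp only: inner_prod_def inner_real_def fst_conv snd_conv gen)
  qed
qed

text \<open>
  The maximizer of the Legendre transform at \<open>(x, y)\<close> is \<open>(t, l)\<close> with \<open>l = lambda_fun \<phi> (y - x\<^sup>2)\<close> and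
  \<open>t\<close> the optimal linear parameter for that \<open>l\<close>.
\<close>

lemma K_S_finite_imp_gradient:
  assumes phi: "\<phi> \<in> {-1<..<1}" and fin: "K_S \<phi> z < \<infinity>"
  shows "\<exists>\<theta>\<in>ma1_domain \<phi>. (ma1_log_mgf \<phi> has_derivative (\<lambda>h. z \<bullet> h)) (at \<theta>)"
proof -
  obtain x y where z: "z = (x, y)" by fastforce
  define c where "c = y - x\<^sup>2"
  have c: "c > 0" using fin by (auto simp: K_S_def z c_def split: if_splits)
  define l where "l = lambda_fun \<phi> c"
  define u where "u = sqrt (1 - 2 * l * (1 + \<phi>)\<^sup>2)"
  note crit = lambda_fun_critical[OF phi c, folded l_def]
  have al: "(1 + \<phi>)\<^sup>2 > 0" using phi by auto
  have u: "u > 0" using crit by (simp add: u_def)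
  define t where "t = x * u\<^sup>2 / (1 + \<phi>)\<^sup>2"
  have dom: "(t, l) \<in> ma1_domain \<phi>" using crit by (simp add: ma1_domain_def)
  define v where "v = sqrt (1 - 2 * l * (1 - \<phi>)\<^sup>2)"
  have stat: "((1 + \<phi>)\<^sup>2 / u + (1 - \<phi>)\<^sup>2 / v) / (u + v) = c"
    using lambda_fun_stationary[OF phi c] unfolding l_def u_def v_def .
  have tx: "t * (1 + \<phi>)\<^sup>2 / u\<^sup>2 = x" using u al by (simp add: t_def)
  have "(x, x\<^sup>2 + c) = z" by (simp add: z c_def)
  then have "(ma1_log_mgf \<phi> has_derivative (\<lambda>h. z \<bullet> h)) (at (t, l))"
    using ma1_log_mgf_has_derivative[OF dom, folded u_def v_def] by (simp only: stat tx)
  with dom show ?thesis by blast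
qed

section \<open>The large deviation principle\<close>

theorem mainTheorem3:
  fixes M :: "'a measure" and \<epsilon> :: "nat \<Rightarrow> 'a \<Rightarrow> real" and \<phi> :: real
  assumes "prob_space M"
    and "\<phi> \<in> {-1<..<1}"
    and "prob_space.indep_vars M (\<lambda>_. borel) \<epsilon> UNIV"
    and "\<And>n. distributed M lborel (\<epsilon> n) std_normal_density"
  shows "satisfies_LDP M (S_vec (ma1 \<phi> \<epsilon>)) (K_S \<phi>) \<and> good_rate (K_S \<phi>)"
proof -
  interpret prob_space M by (rule assms(1))
  have [measurable]: "\<epsilon> n \<in> borel_measurable M" for n
    using distributed_measurable[OF assms(4)[of n]] by simp
  interpret log_mgf_limit M "S_vec (ma1 \<phi> \<epsilon>)" "ma1_domain \<phi>" "ma1_log_mgf \<phi>"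
  proof
    show "S_vec (ma1 \<phi> \<epsilon>) n \<in> borel_measurable M" for n
      unfolding S_vec_def ma1_def by measurable
    show "0 \<in> ma1_domain \<phi>"
      by (simp add: ma1_domain_def zero_prod_def)
  qed (use ma1_mgf[OF assms(3,4)] open_ma1_domain in \<open>auto simp: split_paired_all\<close>)
  have K: "rate = K_S \<phi>"
    unfolding fun_eq_iff rate_def K_S_eq_Legendre_transform[OF assms(2)] by simp
  have "satisfies_LDP M (S_vec (ma1 \<phi> \<epsilon>)) rate"
    using K_S_finite_imp_gradient[OF assms(2)] by (intro LDP_if_rate_points_are_gradients) (simp add: K)
  then show ?thesis using good_rate_rate by (simp add: K)
qed

end
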